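(* Let $X$ be a simply-connected complex manifold equipped with a complete Kähler metric with Kähler form $\omega$. Suppose that $\omega$ admits a global potential $g:X\to\mathbb{R}$, i.e. $dd^c g=\omega$, satisfying the following conditions: (1) $g$ is an exhaustion function on $X$; (2) there exists $C>0$ such that $$\frac12\liminf_{x\to\infty}|\partial g|^2_\omega(x)=\liminf_{x\to\infty}|d^c g|^2_\omega(x)\ge C .$$ Then for any global $1$-form $\eta$ on $X$ satisfying $d\eta=\omega$, we have $$\|\eta\|_{L^\infty}^2\ge C .$$ In particular, the Kähler hyperbolicity modulus satisfies $\mathsf{M}(X,\omega)\ge C$.
   Context: Manifolds are connected; functions and forms are smooth; the $1$-forms $\eta$ are real. The operator $d^c$ is normalized so that $dd^c=\sqrt{-1}\,\partial\bar\partial$, i.e. $d^c=\frac{\sqrt{-1}}{2}(\bar\partial-\partial)$. If $\omega=\sqrt{-1}\,h_{\alpha\bar\beta}\,dz^\alpha\wedge d\bar z^{\beta}$ in local coordinates, then $|\partial g|^2_\omega=h^{\alpha\bar\beta}g_\alpha g_{\bar\beta}$, where $(h^{\alpha\bar\beta})$ is the inverse matrix. For a real $1$-form $\eta$, $|\eta|_\omega$ is the pointwise length with respect to the Riemannian metric $\omega(\cdot,J\cdot)$ associated with $\omega$ (in dimension one, $\omega=\sqrt{-1}\,h\,dz\wedge d\bar z$ corresponds to $2h(dx^2+dy^2)$). With these conventions $|d^cg|^2_\omega=\frac12|\partial g|^2_\omega$ pointwise for every real function $g$, so the equality displayed in (2) is automatic. Put $\|\eta\|_{L^\infty}=\sup_X|\eta|_\omega\in[0,+\infty]$.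 The Kähler hyperbolicity modulus of $(X,\omega)$ is $$\mathsf{M}(X,\omega)=\inf\{\|\eta\|^2_{L^\infty}:\ \eta \text{ is a real } 1\text{-form on } X \text{ with } d\eta=\omega\}.$$ An exhaustion function is a function $g$ with $\{x\in X: g(x)<c\}$ relatively compact in $X$ for all $c\in\mathbb{R}$. A sequence $(x_j)$ in $X$ is compactly divergent if for each compact $K\subset X$ there is $N$ such that $x_j\in X\setminus K$ for all $j\ge N$. For $f:X\to\mathbb{R}$, $\liminf_{x\to\infty}f(x)$ denotes the infimum of $\liminf_{j\to\infty}f(x_j)$ over all compactly divergent sequences $(x_j)$ in $X$. *)

theory Defs
  imports "HOL-Analysis.Analysis"
begin

section \<open>Smooth and holomorphic maps\<close>

primrec Ck_on :: "nat \<Rightarrow> ('e::euclidean_space \<Rightarrow> 'f::real_normed_vector) \<Rightarrow> 'e set \<Rightarrow> bool" where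
  "Ck_on 0 f S \<longleftrightarrow> continuous_on S f"
| "Ck_on (Suc k) f S \<longleftrightarrow>
     (\<forall>x\<in>S. f differentiable (at x)) \<and> (\<forall>v. Ck_on k (\<lambda>x. frechet_derivative f (at x) v) S)"

definition smooth_on :: "('e::euclidean_space \<Rightarrow> 'f::real_normed_vector) \<Rightarrow> 'e set \<Rightarrow> bool" where
  "smooth_on f S \<longleftrightarrow> (\<forall>k. Ck_on k f S)"

definition holomorphic_map_on ::
    "(complex ^ 'n::finite \<Rightarrow> complex ^ 'm::finite) \<Rightarrow> (complex ^ 'n) set \<Rightarrow> bool" where
  "holomorphic_map_on f S \<longleftrightarrow>
     (\<forall>z\<in>S. \<exists>D. (f has_derivative D) (at z) \<and> (\<forall>a v. D (a *s v) = a *s D v))"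

section \<open>Complex manifolds\<close>

text \<open>
  The underlying space of the manifold is a whole type, whose sort provides the Hausdorff property
  and second countability.  A chart is a pair \<open>(U, \<phi>)\<close>.  The complex dimension is
  \<open>CARD('n) \<ge> 1\<close>.
\<close>

type_synonym ('a, 'n) chart = "'a set \<times> ('a \<Rightarrow> complex ^ 'n)"

abbreviation chart_image :: "('a, 'n::finite) chart \<Rightarrow> (complex ^ 'n) set" where
  "chart_image c \<equiv> snd c ` fst c"

abbreviation chart_inv :: "('a, 'n::finite) chart \<Rightarrow> complex ^ 'n \<Rightarrow> 'a" where
  "chart_inv c \<equiv> inv_into (fst c) (snd c)"

definition is_chart :: "('a::topological_space, 'n::finite) chart \<Rightarrow> bool" where
  "is_chart c \<longleftrightarrow> open (fst c) \<and> open (chart_image c) \<and>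
     homeomorphism (fst c) (chart_image c) (snd c) (chart_inv c)"

abbreviation transition ::
    "('a, 'n::finite) chart \<Rightarrow> ('a, 'n) chart \<Rightarrow> complex ^ 'n \<Rightarrow> complex ^ 'n" where
  "transition c d \<equiv> snd d \<circ> chart_inv c"

definition complex_manifold ::
    "('a::{t2_space, second_countable_topology}, 'n::finite) chart set \<Rightarrow> bool" where
  "complex_manifold A \<longleftrightarrow>
     connected (UNIV :: 'a set) \<and>
     (\<forall>c\<in>A. is_chart c) \<and> (\<Union>c\<in>A. fst c) = UNIV \<and>
     (\<forall>c\<in>A. \<forall>d\<in>A. holomorphic_map_on (transition c d) (snd c ` (fst c \<inter> fst d)))"

definition smooth_function ::
    "('a, 'n::finite) chart set \<Rightarrow> ('a \<Rightarrow> real) \<Rightarrow> bool" where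
  "smooth_function A g \<longleftrightarrow> (\<forall>c\<in>A. smooth_on (g \<circ> chart_inv c) (chart_image c))"

section \<open>Differential forms\<close>

text \<open>
  A form is the family of its local expressions: \<open>\<eta> c z v\<close> is the value on the tangent vector with
  coordinates \<open>v\<close> at the point with coordinates \<open>z\<close>, in the chart \<open>c\<close>.  The values for
  \<open>z \<notin> chart_image c\<close> are irrelevant.
\<close>

type_synonym ('a, 'n) form1 =
  "('a, 'n) chart \<Rightarrow> complex ^ 'n \<Rightarrow> complex ^ 'n \<Rightarrow> real"
type_synonym ('a, 'n) form2 =
  "('a, 'n) chart \<Rightarrow> complex ^ 'n \<Rightarrow> complex ^ 'n \<Rightarrow> complex ^ 'n \<Rightarrow> real"

definition one_form :: "('a, 'n::finite) chart set \<Rightarrow> ('a, 'n) form1 \<Rightarrow> bool" where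
  "one_form A \<eta> \<longleftrightarrow>
     (\<forall>c\<in>A. \<forall>z\<in>chart_image c. linear (\<eta> c z)) \<and>
     (\<forall>c\<in>A. \<forall>v. smooth_on (\<lambda>z. \<eta> c z v) (chart_image c)) \<and>
     (\<forall>c\<in>A. \<forall>d\<in>A. \<forall>x\<in>fst c \<inter> fst d. \<forall>v.
        \<eta> c (snd c x) v =
        \<eta> d (snd d x) (frechet_derivative (transition c d) (at (snd c x)) v))"

definition two_form :: "('a, 'n::finite) chart set \<Rightarrow> ('a, 'n) form2 \<Rightarrow> bool" where
  "two_form A \<omega> \<longleftrightarrow>
     (\<forall>c\<in>A. \<forall>z\<in>chart_image c. bilinear (\<omega> c z) \<and> (\<forall>v. \<omega> c z v v = 0)) \<and>
     (\<forall>c\<in>A. \<forall>v w. smooth_on (\<lambda>z. \<omega> c z v w) (chart_image c)) \<and>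
     (\<forall>c\<in>A. \<forall>d\<in>A. \<forall>x\<in>fst c \<inter> fst d. \<forall>v w.
        \<omega> c (snd c x) v w =
        \<omega> d (snd d x) (frechet_derivative (transition c d) (at (snd c x)) v)
                      (frechet_derivative (transition c d) (at (snd c x)) w))"

definition eq_form2 ::
    "('a, 'n::finite) chart set \<Rightarrow> ('a, 'n) form2 \<Rightarrow> ('a, 'n) form2 \<Rightarrow> bool" where
  "eq_form2 A \<omega> \<omega>' \<longleftrightarrow> (\<forall>c\<in>A. \<forall>z\<in>chart_image c. \<forall>v w. \<omega> c z v w = \<omega>' c z v w)"

text \<open>
  Exterior derivatives are computed on constant vector fields, with the convention
  \<open>(\<alpha> \<and> \<beta>)(v, w) = \<alpha>(v) \<beta>(w) - \<alpha>(w) \<beta>(v)\<close>.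
\<close>

definition ext_deriv1 :: "('a, 'n::finite) form1 \<Rightarrow> ('a, 'n) form2" where
  "ext_deriv1 \<eta> c z v w =
     frechet_derivative (\<lambda>y. \<eta> c y w) (at z) v - frechet_derivative (\<lambda>y. \<eta> c y v) (at z) w"

definition closed_form2 :: "('a, 'n::finite) chart set \<Rightarrow> ('a, 'n) form2 \<Rightarrow> bool" where
  "closed_form2 A \<omega> \<longleftrightarrow> (\<forall>c\<in>A. \<forall>z\<in>chart_image c. \<forall>u v w.
       frechet_derivative (\<lambda>y. \<omega> c y v w) (at z) u
     - frechet_derivative (\<lambda>y. \<omega> c y u w) (at z) v
     + frechet_derivative (\<lambda>y. \<omega> c y u v) (at z) w = 0)"

text \<open>The coefficients \<open>g\<^sub>\<alpha>\<close> and \<open>g\<close> with index \<open>\<alpha>\<close> barred, for a real function \<open>g\<close>.\<close>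

definition wirtinger ::
    "('a \<Rightarrow> real) \<Rightarrow> ('a, 'n::finite) chart \<Rightarrow> complex ^ 'n \<Rightarrow> 'n \<Rightarrow> complex" where
  "wirtinger g c z \<alpha> =
     (complex_of_real (frechet_derivative (g \<circ> chart_inv c) (at z) (axis \<alpha> 1))
      - \<i> * complex_of_real (frechet_derivative (g \<circ> chart_inv c) (at z) (axis \<alpha> \<i>))) / 2"

definition wirtinger_bar ::
    "('a \<Rightarrow> real) \<Rightarrow> ('a, 'n::finite) chart \<Rightarrow> complex ^ 'n \<Rightarrow> 'n \<Rightarrow> complex" where
  "wirtinger_bar g c z \<alpha> =
     (complex_of_real (frechet_derivative (g \<circ> chart_inv c) (at z) (axis \<alpha> 1))
      + \<i> * complex_of_real (frechet_derivative (g \<circ> chart_inv c) (at z) (axis \<alpha> \<i>))) / 2"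

definition del ::
    "('a \<Rightarrow> real) \<Rightarrow> ('a, 'n::finite) chart \<Rightarrow> complex ^ 'n \<Rightarrow> complex ^ 'n \<Rightarrow> complex" where
  "del g c z v = (\<Sum>\<alpha>\<in>UNIV. wirtinger g c z \<alpha> * v $ \<alpha>)"

definition delbar ::
    "('a \<Rightarrow> real) \<Rightarrow> ('a, 'n::finite) chart \<Rightarrow> complex ^ 'n \<Rightarrow> complex ^ 'n \<Rightarrow> complex" where
  "delbar g c z v = (\<Sum>\<alpha>\<in>UNIV. wirtinger_bar g c z \<alpha> * cnj (v $ \<alpha>))"

text \<open>\<open>Re\<close> is only a coercion here: the argument is real, see \<open>dc_real\<close>.\<close>

definition dc :: "('a \<Rightarrow> real) \<Rightarrow> ('a, 'n::finite) form1" where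
  "dc g c z v = Re (\<i> / 2 * (delbar g c z v - del g c z v))"

section \<open>Kaehler metrics\<close>

text \<open>The Riemannian metric \<open>\<omega>(\<cdot>, J\<cdot>)\<close>.\<close>

definition riem ::
    "('a, 'n::finite) form2 \<Rightarrow> ('a, 'n) chart \<Rightarrow> complex ^ 'n \<Rightarrow> complex ^ 'n \<Rightarrow> complex ^ 'n \<Rightarrow> real"
  where "riem \<omega> c z v w = \<omega> c z v (\<i> *s w)"

definition kaehler_form :: "('a, 'n::finite) chart set \<Rightarrow> ('a, 'n) form2 \<Rightarrow> bool" where
  "kaehler_form A \<omega> \<longleftrightarrow>
     two_form A \<omega> \<and> closed_form2 A \<omega> \<and>
     (\<forall>c\<in>A. \<forall>z\<in>chart_image c.
        (\<forall>v w. \<omega> c z (\<i> *s v) (\<i> *s w) = \<omega> c z v w) \<and>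
        (\<forall>v. v \<noteq> 0 \<longrightarrow> riem \<omega> c z v v > 0))"

text \<open>
  The matrix \<open>h\<close> with \<open>\<omega> = \<i> \<Sum> h\<^sub>\<alpha>\<^sub>\<beta> dz\<^sub>\<alpha> \<and> cnj dz\<^sub>\<beta>\<close>, obtained by evaluating the complex bilinear
  extension of \<open>\<omega>\<close> on \<open>(e\<^sub>\<alpha> - \<i> J e\<^sub>\<alpha>) / 2\<close> and \<open>(e\<^sub>\<beta> + \<i> J e\<^sub>\<beta>) / 2\<close>, which gives \<open>\<i> h\<^sub>\<alpha>\<^sub>\<beta>\<close>.
\<close>

definition herm_coeff ::
    "('a, 'n::finite) form2 \<Rightarrow> ('a, 'n) chart \<Rightarrow> complex ^ 'n \<Rightarrow> complex ^ 'n ^ 'n" where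
  "herm_coeff \<omega> c z = (\<chi> \<alpha> \<beta>. - \<i> / 4 *
     (complex_of_real (\<omega> c z (axis \<alpha> 1) (axis \<beta> 1) + \<omega> c z (axis \<alpha> \<i>) (axis \<beta> \<i>))
      + \<i> * complex_of_real (\<omega> c z (axis \<alpha> 1) (axis \<beta> \<i>) - \<omega> c z (axis \<alpha> \<i>) (axis \<beta> 1))))"

text \<open>
  The matrix with upper indices is the inverse with respect to
  \<open>\<Sum>\<beta>. h\<^sup>\<alpha>\<^sup>\<beta> h\<^sub>\<gamma>\<^sub>\<beta> = \<delta>\<^sub>\<alpha>\<^sub>\<gamma>\<close> (barred indices are contracted with barred ones), hence the transpose.
\<close>

definition herm_inv ::
    "('a, 'n::finite) form2 \<Rightarrow> ('a, 'n) chart \<Rightarrow> complex ^ 'n \<Rightarrow> complex ^ 'n ^ 'n" where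
  "herm_inv \<omega> c z = matrix_inv (transpose (herm_coeff \<omega> c z))"

definition local_del_norm_sq ::
    "('a, 'n::finite) form2 \<Rightarrow> ('a \<Rightarrow> real) \<Rightarrow> ('a, 'n) chart \<Rightarrow> complex ^ 'n \<Rightarrow> real" where
  "local_del_norm_sq \<omega> g c z =
     Re (\<Sum>\<alpha>\<in>UNIV. \<Sum>\<beta>\<in>UNIV.
           herm_inv \<omega> c z $ \<alpha> $ \<beta> * wirtinger g c z \<alpha> * wirtinger_bar g c z \<beta>)"

definition local_form_norm ::
    "('a, 'n::finite) form2 \<Rightarrow> ('a, 'n) form1 \<Rightarrow> ('a, 'n) chart \<Rightarrow> complex ^ 'n \<Rightarrow> real" where
  "local_form_norm \<omega> \<eta> c z = Sup {\<bar>\<eta> c z v\<bar> | v. riem \<omega> c z v v \<le> 1}"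

text \<open>Quantities that do not depend on the chart are evaluated in an arbitrary chart at the point.\<close>

definition chart_at :: "('a, 'n::finite) chart set \<Rightarrow> 'a \<Rightarrow> ('a, 'n) chart" where
  "chart_at A x = (SOME c. c \<in> A \<and> x \<in> fst c)"

definition del_norm_sq ::
    "('a, 'n::finite) chart set \<Rightarrow> ('a, 'n) form2 \<Rightarrow> ('a \<Rightarrow> real) \<Rightarrow> 'a \<Rightarrow> real" where
  "del_norm_sq A \<omega> g x = local_del_norm_sq \<omega> g (chart_at A x) (snd (chart_at A x) x)"

definition form_norm ::
    "('a, 'n::finite) chart set \<Rightarrow> ('a, 'n) form2 \<Rightarrow> ('a, 'n) form1 \<Rightarrow> 'a \<Rightarrow> real" where
  "form_norm A \<omega> \<eta> x = local_form_norm \<omega> \<eta> (chart_at A x) (snd (chart_at A x) x)"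

definition Linf_norm ::
    "('a, 'n::finite) chart set \<Rightarrow> ('a, 'n) form2 \<Rightarrow> ('a, 'n) form1 \<Rightarrow> ereal" where
  "Linf_norm A \<omega> \<eta> = (SUP x. ereal (form_norm A \<omega> \<eta> x))"

definition kaehler_hyp_modulus ::
    "('a, 'n::finite) chart set \<Rightarrow> ('a, 'n) form2 \<Rightarrow> ereal" where
  "kaehler_hyp_modulus A \<omega> =
     Inf {(Linf_norm A \<omega> \<eta>)\<^sup>2 | \<eta>. one_form A \<eta> \<and> eq_form2 A (ext_deriv1 \<eta>) \<omega>}"

section \<open>Completeness\<close>

definition piecewise_C1_path ::
    "('a::topological_space, 'n::finite) chart set \<Rightarrow> (real \<Rightarrow> 'a) \<Rightarrow> bool" where
  "piecewise_C1_path A \<gamma> \<longleftrightarrow> path \<gamma> \<and>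
     (\<forall>c\<in>A. \<forall>a b. {a..b} \<subseteq> {0..1} \<and> \<gamma> ` {a..b} \<subseteq> fst c \<longrightarrow>
        (snd c \<circ> \<gamma>) piecewise_C1_differentiable_on {a..b})"

definition speed ::
    "('a, 'n::finite) chart set \<Rightarrow> ('a, 'n) form2 \<Rightarrow> (real \<Rightarrow> 'a) \<Rightarrow> real \<Rightarrow> real" where
  "speed A \<omega> \<gamma> t =
     (let c = chart_at A (\<gamma> t); v = vector_derivative (snd c \<circ> \<gamma>) (at t)
      in sqrt (riem \<omega> c (snd c (\<gamma> t)) v v))"

text \<open>
  The derivative of a piecewise C1 path in the sense of the library may be unbounded near the
  finitely many exceptional points, so the length is taken in \<open>[0, \<infinity>]\<close>.
\<close>

definition path_length ::
    "('a, 'n::finite) chart set \<Rightarrow> ('a, 'n) form2 \<Rightarrow> (real \<Rightarrow> 'a) \<Rightarrow> ennreal" where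
  "path_length A \<omega> \<gamma> = (\<integral>\<^sup>+ t. ennreal (speed A \<omega> \<gamma> t) * indicator {0..1} t \<partial>lborel)"

definition riem_dist ::
    "('a::topological_space, 'n::finite) chart set \<Rightarrow> ('a, 'n) form2 \<Rightarrow> 'a \<Rightarrow> 'a \<Rightarrow> ennreal" where
  "riem_dist A \<omega> x y =
     Inf {path_length A \<omega> \<gamma> | \<gamma>. piecewise_C1_path A \<gamma> \<and> pathstart \<gamma> = x \<and> pathfinish \<gamma> = y}"

definition complete_metric ::
    "('a::topological_space, 'n::finite) chart set \<Rightarrow> ('a, 'n) form2 \<Rightarrow> bool" where
  "complete_metric A \<omega> \<longleftrightarrow>
     (\<forall>s :: nat \<Rightarrow> 'a.
        (\<forall>e>0. \<exists>N. \<forall>m\<ge>N. \<forall>n\<ge>N. riem_dist A \<omega> (s m) (s n) < e) \<longrightarrow>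
        (\<exists>l. (\<lambda>n. riem_dist A \<omega> (s n) l) \<longlonglongrightarrow> 0))"

section \<open>Behaviour at infinity\<close>

definition exhaustion_function :: "('a::topological_space \<Rightarrow> real) \<Rightarrow> bool" where
  "exhaustion_function g \<longleftrightarrow> (\<forall>c. compact (closure {x. g x < c}))"

definition compactly_divergent :: "(nat \<Rightarrow> 'a::topological_space) \<Rightarrow> bool" where
  "compactly_divergent s \<longleftrightarrow> (\<forall>K. compact K \<longrightarrow> (\<exists>N. \<forall>j\<ge>N. s j \<notin> K))"

definition liminf_infinity :: "('a::topological_space \<Rightarrow> real) \<Rightarrow> ereal" where
  "liminf_infinity f = Inf {liminf (\<lambda>j. ereal (f (s j))) | s. compactly_divergent s}"

section \<open>Consistency of the conventions\<close>

lemma wirtinger_bar_cnj: "wirtinger_bar g c z \<alpha> = cnj (wirtinger g c z \<alpha>)"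
  by (simp add: wirtinger_bar_def wirtinger_def)

lemma delbar_cnj: "delbar g c z v = cnj (del g c z v)"
  by (simp add: delbar_def del_def wirtinger_bar_cnj)

lemma dc_Im: "dc g c z v = Im (del g c z v)"
  by (simp add: dc_def delbar_cnj)

lemma dc_real: "\<i> / 2 * (delbar g c z v - del g c z v) \<in> \<real>"
  by (simp add: delbar_cnj complex_is_Real_iff)


lemma axis_i: "axis \<alpha> \<i> = \<i> *s (axis \<alpha> (1::complex) :: complex ^ 'n::finite)"
  by (simp add: vec_eq_iff axis_def)

lemma vector_smult_alt:
  fixes x :: "complex ^ 'n::finite"
  shows "a *s x = Re a *\<^sub>R x + Im a *\<^sub>R (\<i> *s x)"
  by (simp add: vec_eq_iff complex_eq_iff)

text \<open>\<open>herm_form\<close> is the hermitian form \<open>\<Sum> h\<^sub>\<alpha>\<^sub>\<beta> v\<^sub>\<alpha> cnj w\<^sub>\<beta>\<close>, so that \<open>\<omega> = \<i> \<Sum> h\<^sub>\<alpha>\<^sub>\<beta> dz\<^sub>\<alpha> \<and> cnj dz\<^sub>\<beta>\<close>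
  reads \<open>\<omega>(v, w) = \<i> (herm_form v w - herm_form w v)\<close>.\<close>

definition herm_form ::
    "('a, 'n::finite) form2 \<Rightarrow> ('a, 'n) chart \<Rightarrow> complex ^ 'n \<Rightarrow> complex ^ 'n \<Rightarrow> complex ^ 'n \<Rightarrow> complex"
  where "herm_form \<omega> c z v w =
    (\<Sum>\<alpha>\<in>UNIV. \<Sum>\<beta>\<in>UNIV. herm_coeff \<omega> c z $ \<alpha> $ \<beta> * v $ \<alpha> * cnj (w $ \<beta>))"

locale hermitian_point =
  fixes \<omega> :: "('a, 'n::finite) form2" and c :: "('a, 'n) chart" and z :: "complex ^ 'n"
  assumes bil: "bilinear (\<omega> c z)" and alt: "\<And>v. \<omega> c z v v = 0"
    and J: "\<And>v w. \<omega> c z (\<i> *s v) (\<i> *s w) = \<omega> c z v w"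
    and pos: "\<And>v. v \<noteq> 0 \<Longrightarrow> \<omega> c z v (\<i> *s v) > 0"
begin

lemmas bil_simps = bilinear_ladd[OF bil] bilinear_radd[OF bil] bilinear_lmul[OF bil]
  bilinear_rmul[OF bil] bilinear_lneg[OF bil] bilinear_rneg[OF bil]
  bilinear_lzero[OF bil] bilinear_rzero[OF bil]

lemma antisym: "\<omega> c z w v = - \<omega> c z v w"
  using alt[of "v + w"] alt[of v] alt[of w] by (simp add: bil_simps)

lemma ii: "\<i> *s (\<i> *s v) = - (v :: complex ^ 'n)"
  by (simp add: vec_eq_iff)

lemma J1: "\<omega> c z (\<i> *s v) w = - \<omega> c z v (\<i> *s w)"
  using J[of v "\<i> *s w"] by (simp add: ii bil_simps)

lemma herm_coeff_eq: "herm_coeff \<omega> c z $ \<alpha> $ \<beta> =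
    Complex (\<omega> c z (axis \<alpha> 1) (\<i> *s axis \<beta> 1) / 2) (- \<omega> c z (axis \<alpha> 1) (axis \<beta> 1) / 2)"
  by (simp add: herm_coeff_def axis_i J J1 ii bil_simps complex_eq_iff)

lemma herm_coeff_cnj: "cnj (herm_coeff \<omega> c z $ \<alpha> $ \<beta>) = herm_coeff \<omega> c z $ \<beta> $ \<alpha>"
  using antisym[of "axis \<alpha> 1" "axis \<beta> 1"] antisym[of "axis \<beta> 1" "\<i> *s axis \<alpha> 1"]
  by (simp add: herm_coeff_eq complex_eq_iff J1 ii bil_simps)

lemma herm_form_eq:
  "herm_form \<omega> c z v w = Complex (\<omega> c z v (\<i> *s w) / 2) (- \<omega> c z v w / 2)"
proof -
  define B where "B v w = Complex (\<omega> c z v (\<i> *s w) / 2) (- \<omega> c z v w / 2)" for v w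
  have s: "\<omega> c z (a *s x) y = Re a * \<omega> c z x y - Im a * \<omega> c z x (\<i> *s y)" for a x y
    by (subst vector_smult_alt) (simp add: bil_simps J1)
  have s': "\<omega> c z x (a *s y) = Re a * \<omega> c z x y + Im a * \<omega> c z x (\<i> *s y)" for a x y
    by (subst vector_smult_alt) (simp add: bil_simps)
  have comm: "\<i> *s (a *s x) = a *s (\<i> *s x)" for a and x :: "complex ^ 'n"
    by (simp add: vec_eq_iff)
  have B1: "B (a *s x) y = a * B x y" for a x y
    by (simp add: B_def s complex_eq_iff ii bil_simps field_simps)
  have B2: "B x (a *s y) = cnj a * B x y" for a x y
    by (simp add: B_def s'[of _ a] s'[of _ "\<i> * a"] complex_eq_iff bil_simps field_simps)
  have d: "\<i> *s (x + y) = \<i> *s x + \<i> *s (y :: complex ^ 'n)" for x y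
    by (simp add: vec_eq_iff algebra_simps)
  have z0: "\<i> *s 0 = (0 :: complex ^ 'n)" by (simp add: vec_eq_iff)
  have add1: "B (x + x') y = B x y + B x' y" for x x' y
    by (simp add: B_def complex_eq_iff bil_simps field_simps)
  have add2: "B x (y + y') = B x y + B x y'" for x y y'
    by (simp add: B_def complex_eq_iff bil_simps d field_simps)
  have zero1: "B 0 y = 0" and zero2: "B x 0 = 0" for x y
    by (simp_all add: B_def complex_eq_iff bil_simps z0)
  have sum1: "B (\<Sum>i\<in>S. f i) y = (\<Sum>i\<in>S. B (f i) y)" if "finite S" for S :: "'n set" and f y
    using that by (induction S) (simp_all add: add1 zero1)
  have sum2: "B x (\<Sum>i\<in>S. f i) = (\<Sum>i\<in>S. B x (f i))" if "finite S" for S :: "'n set" and f x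
    using that by (induction S) (simp_all add: add2 zero2)
  have ex: "x = (\<Sum>i\<in>UNIV. x $ i *s axis i 1)" for x :: "complex ^ 'n"
    by (simp add: basis_expansion)
  have "B v w = (\<Sum>\<alpha>\<in>UNIV. \<Sum>\<beta>\<in>UNIV. v $ \<alpha> * (cnj (w $ \<beta>) * B (axis \<alpha> 1) (axis \<beta> 1)))"
    by (subst ex[of v], subst ex[of w], simp only: sum1 sum2 finite B1 B2 sum_distrib_left,
        subst sum.swap, simp only: mult.left_commute)
  also have "\<dots> = herm_form \<omega> c z v w"
    unfolding herm_form_def by (simp only: herm_coeff_eq[folded B_def] mult_ac)
  finally show ?thesis by (simp add: B_def)
qed

lemma form_eq_herm: "complex_of_real (\<omega> c z v w) = \<i> * (herm_form \<omega> c z v w - herm_form \<omega> c z w v)"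
proof -
  have "\<omega> c z w (\<i> *s v) = \<omega> c z v (\<i> *s w)"
    by (subst antisym) (simp only: J1 minus_minus)
  moreover have "\<omega> c z w v = - \<omega> c z v w" by (rule antisym)
  ultimately show ?thesis by (simp only: herm_form_eq complex_eq_iff) simp
qed

lemma riem_cauchy_schwarz:
  "(\<omega> c z v (\<i> *s w))\<^sup>2 \<le> \<omega> c z v (\<i> *s v) * \<omega> c z w (\<i> *s w)"
proof (cases "w = 0")
  case False
  define G where "G v w = \<omega> c z v (\<i> *s w)" for v w
  have d: "\<i> *s (x - y) = \<i> *s x - \<i> *s (y :: complex ^ 'n)" for x y
    by (simp add: vec_eq_iff algebra_simps)
  have d2: "\<i> *s (r *\<^sub>R x) = r *\<^sub>R (\<i> *s (x :: complex ^ 'n))" for r x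
    by (simp add: vec_eq_iff)
  have sym: "G w v = G v w"
    using antisym[of "\<i> *s v" w] by (simp add: G_def J1)
  define t where "t = G v w / G w w"
  have gw: "G w w > 0" using pos[OF False] by (simp add: G_def)
  have "0 \<le> G (v - t *\<^sub>R w) (v - t *\<^sub>R w)"
    using pos[of "v - t *\<^sub>R w"] by (cases "v - t *\<^sub>R w = 0") (auto simp: G_def bil_simps)
  also have "\<dots> = G v v - t * G v w - t * G w v + t\<^sup>2 * G w w"
    by (simp add: G_def d d2 bilinear_lsub[OF bil] bilinear_rsub[OF bil] bil_simps power2_eq_square
        algebra_simps)
  also have "\<dots> = G v v - (G v w)\<^sup>2 / G w w"
    using gw by (simp add: sym t_def power2_eq_square field_simps)
  finally show ?thesis using gw by (simp add: G_def field_simps)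
next
  case True
  then have "\<i> *s w = 0" by (simp add: vec_eq_iff)
  then show ?thesis using True by (simp add: bil_simps)
qed

lemma herm_inv_right: "transpose (herm_coeff \<omega> c z) ** herm_inv \<omega> c z = mat 1"
proof -
  have "x = 0" if x: "transpose (herm_coeff \<omega> c z) *v x = 0" for x
  proof (rule ccontr)
    assume "x \<noteq> 0"
    have "herm_form \<omega> c z x x =
        (\<Sum>\<beta>\<in>UNIV. cnj (x $ \<beta>) * ((transpose (herm_coeff \<omega> c z) *v x) $ \<beta>))"
      unfolding herm_form_def
      by (subst sum.swap) (simp add: matrix_vector_mult_def transpose_def sum_distrib_left mult_ac)
    also have "\<dots> = 0" by (simp only: x) simp
    finally have "\<omega> c z x (\<i> *s x) = 0" by (simp add: herm_form_eq complex_eq_iff)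
    then show False using pos[OF \<open>x \<noteq> 0\<close>] by simp
  qed
  then obtain B where "B ** transpose (herm_coeff \<omega> c z) = mat 1"
    using matrix_left_invertible_ker by blast
  then have "invertible (transpose (herm_coeff \<omega> c z))"
    using invertible_left_inverse by blast
  then show ?thesis
    unfolding herm_inv_def invertible_def matrix_inv_def by (rule someI2_ex) auto
qed

text \<open>The pointwise identity between the norms of \<open>dc g\<close> and of the form \<open>\<partial>g\<close>.\<close>

lemma local_dc_norm: "(local_form_norm \<omega> (dc g) c z)\<^sup>2 = local_del_norm_sq \<omega> g c z / 2"
proof -
  define a where "a = (\<chi> \<alpha>. wirtinger g c z \<alpha>)"
  define ca where "ca = (\<chi> \<alpha>. wirtinger_bar g c z \<alpha>)"
  define b where "b = herm_inv \<omega> c z *v ca"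
  have "transpose (herm_coeff \<omega> c z) *v b = ca"
    by (simp add: b_def matrix_vector_mul_assoc herm_inv_right)
  then have "(\<Sum>\<beta>\<in>UNIV. herm_coeff \<omega> c z $ \<beta> $ \<alpha> * b $ \<beta>) = ca $ \<alpha>" for \<alpha>
    by (auto simp: matrix_vector_mult_def transpose_def vec_eq_iff)
  then have "cnj (\<Sum>\<beta>\<in>UNIV. herm_coeff \<omega> c z $ \<beta> $ \<alpha> * b $ \<beta>) = a $ \<alpha>" for \<alpha>
    by (simp add: ca_def a_def wirtinger_bar_cnj)
  then have ab: "(\<Sum>\<beta>\<in>UNIV. herm_coeff \<omega> c z $ \<alpha> $ \<beta> * cnj (b $ \<beta>)) = a $ \<alpha>" for \<alpha>
    by (simp add: herm_coeff_cnj)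
  have H: "herm_form \<omega> c z v b = del g c z v" for v
  proof -
    have "herm_form \<omega> c z v b =
        (\<Sum>\<alpha>\<in>UNIV. (\<Sum>\<beta>\<in>UNIV. herm_coeff \<omega> c z $ \<alpha> $ \<beta> * cnj (b $ \<beta>)) * v $ \<alpha>)"
      by (simp add: herm_form_def sum_distrib_left sum_distrib_right mult_ac)
    then show ?thesis by (simp add: ab del_def a_def)
  qed
  have dcv: "dc g c z v = - \<omega> c z v b / 2" for v
    by (simp add: dc_Im H[symmetric] herm_form_eq)
  have N: "local_del_norm_sq \<omega> g c z = \<omega> c z b (\<i> *s b) / 2"
  proof -
    have "local_del_norm_sq \<omega> g c z = Re (del g c z b)"
      by (simp add: local_del_norm_sq_def del_def b_def ca_def matrix_vector_mult_def
          sum_distrib_left mult_ac)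
    then show ?thesis by (simp add: H[symmetric] herm_form_eq)
  qed
  define G where "G = \<omega> c z b (\<i> *s b)"
  have G0: "G \<ge> 0" using pos[of b] by (cases "b = 0") (auto simp: G_def bil_simps)
  have bound: "\<bar>dc g c z v\<bar> \<le> sqrt G / 2" if "riem \<omega> c z v v \<le> 1" for v
  proof -
    have "(\<omega> c z v b)\<^sup>2 = (\<omega> c z (- (\<i> *s v)) (\<i> *s b))\<^sup>2"
      by (simp add: bil_simps J)
    also have "\<dots> \<le> \<omega> c z (- (\<i> *s v)) (\<i> *s (- (\<i> *s v))) * G"
      unfolding G_def by (rule riem_cauchy_schwarz)
    also have "\<i> *s (- (\<i> *s v)) = v" by (simp add: vec_eq_iff)
    also have "\<omega> c z (- (\<i> *s v)) v = riem \<omega> c z v v"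
      by (simp add: bil_simps J1 riem_def)
    also have "riem \<omega> c z v v * G \<le> 1 * G"
      by (rule mult_right_mono) (use that G0 in auto)
    finally have "\<bar>\<omega> c z v b\<bar> \<le> sqrt G"
      by (simp add: real_le_rsqrt)
    then show ?thesis by (simp add: dcv)
  qed
  have att: "\<exists>v. riem \<omega> c z v v \<le> 1 \<and> \<bar>dc g c z v\<bar> = sqrt G / 2"
  proof (cases "G = 0")
    case True
    have "riem \<omega> c z 0 0 \<le> 1" by (simp add: riem_def bil_simps)
    moreover have "dc g c z 0 = 0" by (simp add: dcv bil_simps)
    ultimately show ?thesis using True by (intro exI[of _ 0]) simp
  next
    case False
    define v where "v = (1 / sqrt G) *\<^sub>R (\<i> *s b)"
    have iv: "\<i> *s v = (1 / sqrt G) *\<^sub>R (- b)"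
      by (simp add: v_def vec_eq_iff)
    have "riem \<omega> c z v v = G / (sqrt G * sqrt G)"
      by (simp add: riem_def iv) (simp add: v_def bil_simps J1 G_def)
    then have "riem \<omega> c z v v = 1" using False G0 by simp
    moreover have "dc g c z v = G / sqrt G / 2"
      by (simp add: dcv v_def bil_simps J1 G_def)
    then have "\<bar>dc g c z v\<bar> = sqrt G / 2" using G0 by (simp only: real_div_sqrt) simp
    ultimately show ?thesis by (intro exI[of _ v]) simp
  qed
  have "local_form_norm \<omega> (dc g) c z = sqrt G / 2"
    unfolding local_form_norm_def
  proof (rule cSup_eq_maximum)
    show "sqrt G / 2 \<in> {\<bar>dc g c z v\<bar> |v. riem \<omega> c z v v \<le> 1}" using att by force
  qed (use bound in auto)
  then have "(local_form_norm \<omega> (dc g) c z)\<^sup>2 = (sqrt G / 2)\<^sup>2" by (rule arg_cong)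
  also have "\<dots> = G / 4" using G0 by (simp add: power_divide)
  finally show ?thesis by (simp add: N G_def)
qed

end

lemma hermitian_point_kaehler:
  assumes "kaehler_form A \<omega>" "c \<in> A" "z \<in> chart_image c"
  shows "hermitian_point \<omega> c z"
  using assms unfolding kaehler_form_def two_form_def riem_def hermitian_point_def by blast

lemma chart_at:
  assumes "complex_manifold A"
  shows "chart_at A x \<in> A" "x \<in> fst (chart_at A x)"
proof -
  have "\<exists>c. c \<in> A \<and> x \<in> fst c" using assms UNIV_I[of x] unfolding complex_manifold_def by blast
  from someI_ex[OF this] show "chart_at A x \<in> A" "x \<in> fst (chart_at A x)"
    by (auto simp: chart_at_def)
qed

lemma dc_norm:
  assumes "complex_manifold A" "kaehler_form A \<omega>"
  shows "(form_norm A \<omega> (dc g) x)\<^sup>2 = 1 / 2 * del_norm_sq A \<omega> g x"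
  using hermitian_point.local_dc_norm[OF hermitian_point_kaehler[OF assms(2) chart_at(1)[OF assms(1)],
      OF imageI, OF chart_at(2)[OF assms(1)]]]
  by (simp add: form_norm_def del_norm_sq_def)

lemma liminf_infinity_half: "liminf_infinity (\<lambda>x. 1 / 2 * f x) = 1 / 2 * liminf_infinity f"
proof -
  have ereal_half: "1 / 2 = ereal (1 / 2)"
    using ereal_divide[of 2 1] by (simp add: one_ereal_def)
  have h: "ereal (1 / 2 * r) = ereal (1 / 2) * ereal r" for r by simp
  have l: "liminf (\<lambda>j. ereal (1 / 2 * f (s j))) = ereal (1 / 2) * liminf (\<lambda>j. ereal (f (s j)))"
    for s :: "nat \<Rightarrow> 'a"
    unfolding h by (subst Liminf_ereal_mult_left) auto
  have "{liminf (\<lambda>j. ereal (1 / 2 * f (s j))) | s. compactly_divergent s} =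
    (\<lambda>y. ereal (1 / 2) * y) ` {liminf (\<lambda>j. ereal (f (s j))) | s. compactly_divergent s}"
    unfolding l by auto
  then have "liminf_infinity (\<lambda>x. 1 / 2 * f x) =
    Inf ((\<lambda>y. ereal (1 / 2) * y) ` {liminf (\<lambda>j. ereal (f (s j))) | s. compactly_divergent s})"
    unfolding liminf_infinity_def by (rule arg_cong)
  also have "Inf ((\<lambda>y. ereal (1 / 2) * y) ` S) = ereal (1 / 2) * Inf S" for S
    using ereal_Inf_cmult[of "1 / 2" "\<lambda>x. x \<in> S"] by (simp add: setcompr_eq_image)
  finally show ?thesis
    by (subst ereal_half) (simp only: liminf_infinity_def)
qed

text \<open>The equality between the two lower limits holds for every real function.\<close>

lemma liminf_dc_norm:
  assumes "complex_manifold A" "kaehler_form A \<omega>"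
  shows "1 / 2 * liminf_infinity (del_norm_sq A \<omega> g) =
         liminf_infinity (\<lambda>x. (form_norm A \<omega> (dc g) x)\<^sup>2)"
  by (simp only: dc_norm[OF assms] liminf_infinity_half)

end

theory Submission
  imports Defs
begin

text \<open>
  Suppose \<open>d\<eta> = \<omega>\<close> with \<open>\<parallel>\<eta>\<parallel>\<^sup>2 < C\<close>. The form \<open>\<eta> - d\<^sup>cg\<close> is closed, hence equals \<open>df\<close> by simple
  connectedness. Since \<open>g\<close> is strictly plurisubharmonic and exhausting, it is unbounded above, and a
  penalised minimisation over a compact slab \<open>\<bar>g - m\<bar> \<le> 1\<close> gives, arbitrarily far out, a point where
  \<open>df\<close> is a multiple of \<open>dg\<close>. The vector \<open>b\<close> dual to \<open>d\<^sup>cg\<close> is tangent to the level sets of \<open>g\<close>, so there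
  \<open>\<eta>(b) = d\<^sup>cg(b) = \<bar>d\<^sup>cg\<bar>\<^sup>2\<close>, whence \<open>\<bar>d\<^sup>cg\<bar> \<le> \<bar>\<eta>\<bar>\<close>, contradicting the lower limit of \<open>\<bar>d\<^sup>cg\<bar>\<^sup>2\<close> at
  infinity.
\<close>

section \<open>Global primitives on simply connected spaces\<close>

text \<open>Simple connectedness provides homotopies that are only continuous, along which a 1-form
  cannot be integrated. Line integrals are therefore replaced by increments of local primitives,
  continued along maps of an interval or a square; calculus enters only in producing the local
  primitives. Minimising \<open>f\<close> on a single level set of \<open>g\<close> would call for a
  regular level before a multiplier rule applies. In a slab with a penalty in
  \<open>(g - m)^2\<close> the minimiser is an interior point, so the plain first-order condition
  suffices: the penalty has differential proportional to \<open>dg\<close>. The function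
  \<open>g\<close> is unbounded above because a bounded one would, by exhaustion, make the manifold
  compact and attain its maximum. There the real Hessian is nonpositive, while
  \<open>dd^c g (v, Jv)\<close> is half the sum of its values at \<open>v\<close> and
  \<open>Jv\<close>. Tangency of \<open>b\<close> rests on \<open>d^c g = - dg o J / 2\<close>:
  \<open>b\<close> is half of \<open>J\<close> applied to the gradient of \<open>g\<close>.\<close>

locale local_primitives =
  fixes P :: "('a::topological_space set \<times> ('a \<Rightarrow> real)) set"
  assumes open_dom: "(U, u) \<in> P \<Longrightarrow> open U"
    and path_connected_dom: "(U, u) \<in> P \<Longrightarrow> path_connected U"
    and cover: "\<exists>U u. (U, u) \<in> P \<and> x \<in> U"
    and compatible: "(U, u) \<in> P \<Longrightarrow> (W, w) \<in> P \<Longrightarrow> x \<in> U \<Longrightarrow> x \<in> W \<Longrightarrow>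
      \<forall>\<^sub>F y in nhds x. u y - u x = w y - w x"
begin

text \<open>This stands in for a line integral along \<open>h\<close>. The source is arbitrary so
  that intervals, squares and, with \<open>h = id\<close>, the manifold itself fall under one
  notion. Increments are compared only near \<open>s\<close>, because overlaps of domains may be
  disconnected and two local primitives may differ there by several constants.\<close>

definition primitive_along :: "('b::topological_space \<Rightarrow> 'a) \<Rightarrow> 'b set \<Rightarrow> ('b \<Rightarrow> real) \<Rightarrow> bool" where
  "primitive_along h S F \<longleftrightarrow> (\<forall>s\<in>S. \<forall>(U, u)\<in>P. h s \<in> U \<longrightarrow>
     (\<forall>\<^sub>F t in nhds s. t \<in> S \<longrightarrow> F t - F s = u (h t) - u (h s)))"

lemma primitive_alongD:
  assumes "primitive_along h S F" "s \<in> S" "(U, u) \<in> P" "h s \<in> U"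
  shows "\<forall>\<^sub>F t in nhds s. t \<in> S \<longrightarrow> F t - F s = u (h t) - u (h s)"
  using assms unfolding primitive_along_def by fast

text \<open>By \<open>compatible\<close>, the increments of \<open>u\<close> near a point are those
  of every other local primitive there.\<close>

lemma primitive_along_local:
  assumes h: "continuous_on S h" "h ` S \<subseteq> U" and U: "(U, u) \<in> P"
  shows "primitive_along h S (u \<circ> h)"
  unfolding primitive_along_def
proof (intro ballI, clarify)
  fix s W w assume s: "s \<in> S" and W: "(W, w) \<in> P" "h s \<in> W"
  have "(h \<longlongrightarrow> h s) (at s within S)" using h(1) s by (simp add: continuous_on)
  moreover have "\<forall>\<^sub>F y in nhds (h s). u y - u (h s) = w y - w (h s)"
    using compatible[OF U W(1) _ W(2)] h(2) s by blast
  ultimately have "\<forall>\<^sub>F t in at s within S. u (h t) - u (h s) = w (h t) - w (h s)"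
    by (rule eventually_compose_filterlim[rotated])
  then show "\<forall>\<^sub>F t in nhds s. t \<in> S \<longrightarrow> (u \<circ> h) t - (u \<circ> h) s = w (h t) - w (h s)"
    unfolding eventually_at_filter by eventually_elim auto
qed

text \<open>Used to restrict to edges and slices of a square and to reparametrise halves of a joined
  path.\<close>

lemma primitive_along_compose:
  assumes F: "primitive_along h S F" and k: "continuous_on T k" "k ` T \<subseteq> S"
  shows "primitive_along (h \<circ> k) T (F \<circ> k)"
  unfolding primitive_along_def
proof (intro ballI, clarify)
  fix t U u assume t: "t \<in> T" and U: "(U, u) \<in> P" "(h \<circ> k) t \<in> U"
  have "(k \<longlongrightarrow> k t) (at t within T)" using k(1) t by (simp add: continuous_on)
  moreover have "\<forall>\<^sub>F y in nhds (k t). y \<in> S \<longrightarrow> F y - F (k t) = u (h y) - u (h (k t))"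
    using primitive_alongD[OF F _ U(1)] U(2) k(2) t by auto
  ultimately have "\<forall>\<^sub>F y in at t within T. k y \<in> S \<longrightarrow> F (k y) - F (k t) = u (h (k y)) - u (h (k t))"
    by (rule eventually_compose_filterlim[rotated])
  then show "\<forall>\<^sub>F y in nhds t. y \<in> T \<longrightarrow> (F \<circ> k) y - (F \<circ> k) t = u ((h \<circ> k) y) - u ((h \<circ> k) t)"
    unfolding eventually_at_filter by eventually_elim (use k(2) in auto)
qed

text \<open>The difference \<open>F - G\<close> is locally constant, since \<open>cover\<close> puts
  each \<open>h a\<close> in a domain whose function prescribes both increments; connectedness makes
  it constant.\<close>

lemma primitive_along_diff_eq:
  assumes F: "primitive_along h S F" and G: "primitive_along h S G"
    and S: "connected S" "s \<in> S" "t \<in> S"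
  shows "F t - F s = G t - G s"
proof -
  have "F s - G s = F t - G t"
  proof (rule connected_local_const[OF S(1,2,3)], intro ballI)
    fix a assume a: "a \<in> S"
    obtain U u where U: "(U, u) \<in> P" "h a \<in> U" using cover by blast
    have "\<forall>\<^sub>F b in nhds a. b \<in> S \<longrightarrow> F a - G a = F b - G b"
      using primitive_alongD[OF F a U] primitive_alongD[OF G a U] by eventually_elim auto
    then show "\<forall>\<^sub>F b in at a within S. F a - G a = F b - G b"
      unfolding eventually_at_filter by eventually_elim auto
  qed
  then show ?thesis by simp
qed

text \<open>On the connected intersection the two functions differ by one constant, which is added
  to \<open>G\<close>; over an empty intersection any constant serves. Closedness gives a point
  outside one piece a neighbourhood missing that piece, so each point is tested only against the
  pieces containing it.\<close>

lemma primitive_along_union: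
  assumes F: "primitive_along h S F" and G: "primitive_along h T G"
    and cl: "closed S" "closed T" and con: "connected (S \<inter> T)"
  obtains H where "primitive_along h (S \<union> T) H"
proof -
  have restrict: "primitive_along h R K" if "primitive_along h R' K" "R \<subseteq> R'"
    for R R' and K :: "_ \<Rightarrow> real"
    unfolding primitive_along_def
  proof (intro ballI, clarify)
    fix s U u assume "s \<in> R" "(U, u) \<in> P" "h s \<in> U"
    then have "\<forall>\<^sub>F t in nhds s. t \<in> R' \<longrightarrow> K t - K s = u (h t) - u (h s)"
      using primitive_alongD[OF that(1), of s U u] that(2) by blast
    then show "\<forall>\<^sub>F t in nhds s. t \<in> R \<longrightarrow> K t - K s = u (h t) - u (h s)"
      by eventually_elim (use that(2) in blast)
  qed
  obtain c where c: "F s = G s + c" if "s \<in> S \<inter> T" for s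
  proof (cases "S \<inter> T = {}")
    case False
    then obtain r where r: "r \<in> S \<inter> T" by blast
    have "F s - F r = G s - G r" if "s \<in> S \<inter> T" for s
      by (rule primitive_along_diff_eq[OF restrict[OF F] restrict[OF G] con r that]) auto
    then show ?thesis using that[of "F r - G r"] by (simp add: algebra_simps)
  qed (use that in blast)
  define H where "H s = (if s \<in> S then F s else G s + c)" for s
  have HS: "H s = F s" if "s \<in> S" for s using that by (simp add: H_def)
  have HT: "H s = G s + c" if "s \<in> T" for s using that c by (simp add: H_def)
  have "primitive_along h (S \<union> T) H"
    unfolding primitive_along_def
  proof (intro ballI, clarify)
    fix s U u assume s: "s \<in> S \<union> T" and U: "(U, u) \<in> P" "h s \<in> U"
    have 1: "\<forall>\<^sub>F t in nhds s. t \<in> S \<longrightarrow> H t - H s = u (h t) - u (h s)"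
    proof (cases "s \<in> S")
      case True
      then show ?thesis using primitive_alongD[OF F True U] by (simp add: HS cong: imp_cong)
    next
      case False
      then have "\<forall>\<^sub>F t in nhds s. t \<in> - S" using cl(1) by (intro eventually_nhds_in_open) auto
      then show ?thesis by eventually_elim auto
    qed
    have 2: "\<forall>\<^sub>F t in nhds s. t \<in> T \<longrightarrow> H t - H s = u (h t) - u (h s)"
    proof (cases "s \<in> T")
      case True
      then show ?thesis using primitive_alongD[OF G True U] by (simp add: HT cong: imp_cong)
    next
      case False
      then have "\<forall>\<^sub>F t in nhds s. t \<in> - T" using cl(2) by (intro eventually_nhds_in_open) auto
      then show ?thesis by eventually_elim auto
    qed
    from 1 2 show "\<forall>\<^sub>F t in nhds s. t \<in> S \<union> T \<longrightarrow> H t - H s = u (h t) - u (h s)"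
      by eventually_elim auto
  qed
  then show ?thesis by (rule that)
qed

text \<open>Small rectangles are mapped into single domains. They are glued along common edges into
  strips, and the strips into the square; \<open>Bolzano\<close> replaces an explicit grid by
  bisection.\<close>

lemma primitive_along_square:
  fixes h :: "real \<times> real \<Rightarrow> 'a"
  assumes h: "continuous_on ({0..1} \<times> {0..1}) h"
  obtains F where "primitive_along h ({0..1} \<times> {0..1}) F"
proof -
  let ?I = "{0..1::real}"
  \<comment> \<open>Open sets of the plane rather than of the square, as
    \<open>Heine_Borel_lemma\<close> asks for; it returns the Lebesgue number \<open>e\<close> of
    this cover.\<close>
  define \<G> where "\<G> = {B. open B \<and> (\<exists>(U, u)\<in>P. h ` (B \<inter> (?I \<times> ?I)) \<subseteq> U)}"
  have sub: "?I \<times> ?I \<subseteq> \<Union>\<G>"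
  proof
    fix s assume s: "s \<in> ?I \<times> ?I"
    obtain U u where U: "(U, u) \<in> P" "h s \<in> U" using cover by blast
    obtain B where B: "open B" "B \<inter> (?I \<times> ?I) = h -` U \<inter> (?I \<times> ?I)"
      using h open_dom[OF U(1)] unfolding continuous_on_open_invariant by blast
    have "B \<in> \<G>" using B U unfolding \<G>_def by blast
    moreover have "s \<in> B" using B U s by blast
    ultimately show "s \<in> \<Union>\<G>" by blast
  qed
  have cpt: "compact (?I \<times> ?I)" by (intro compact_Times) auto
  have opn: "open G" if "G \<in> \<G>" for G using that unfolding \<G>_def by simp
  obtain e where e: "e > 0" "\<And>s. s \<in> ?I \<times> ?I \<Longrightarrow> \<exists>G\<in>\<G>. ball s e \<subseteq> G"
    using Heine_Borel_lemma[OF cpt sub opn] by metis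
  \<comment> \<open>With both sides below \<open>e / 2\<close>, the rectangle lies in the ball of
    radius \<open>e\<close> about any of its points, since the distance is at most the sum of the
    coordinate distances.\<close>
  have small: "\<exists>F. primitive_along h ((?I \<inter> {a..b}) \<times> (?I \<inter> {c..d})) F"
    if "b - a < e / 2" "d - c < e / 2" for a b c d
  proof (cases "(?I \<inter> {a..b}) \<times> (?I \<inter> {c..d}) = {}")
    case True
    then show ?thesis by (simp only: primitive_along_def) simp
  next
    case False
    then obtain x y where xy: "x \<in> ?I \<inter> {a..b}" "y \<in> ?I \<inter> {c..d}" by blast
    obtain G where G: "G \<in> \<G>" "ball (x, y) e \<subseteq> G" using e(2)[of "(x, y)"] xy by blast
    then obtain U u where U: "(U, u) \<in> P" "h ` (G \<inter> (?I \<times> ?I)) \<subseteq> U" unfolding \<G>_def by blast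
    have "(?I \<inter> {a..b}) \<times> (?I \<inter> {c..d}) \<subseteq> ball (x, y) e"
    proof clarify
      fix x' y' assume *: "x' \<in> ?I" "x' \<in> {a..b}" "y' \<in> ?I" "y' \<in> {c..d}"
      have "dist (x, y) (x', y') \<le> dist x x' + dist y y'"
        unfolding dist_Pair_Pair by (rule sqrt_sum_squares_le_sum) auto
      also have "\<dots> < e" using * xy that by (auto simp: dist_real_def)
      finally show "(x', y') \<in> ball (x, y) e" by simp
    qed
    then have "h ` ((?I \<inter> {a..b}) \<times> (?I \<inter> {c..d})) \<subseteq> U" using U G by blast
    then show ?thesis
      using primitive_along_local[OF _ _ U(1)] continuous_on_subset[OF h]
      by (metis Int_lower1 Sigma_mono)
  qed
  have strip: "\<exists>F. primitive_along h ((?I \<inter> {a..b}) \<times> ?I) F" if ab: "b - a < e / 2" for a b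
  proof -
    let ?Q = "\<lambda>p q. \<exists>F. primitive_along h ((?I \<inter> {a..b}) \<times> (?I \<inter> {p..q})) F"
    have "?Q 0 1"
    proof (rule Bolzano[where P = ?Q, OF zero_le_one])
      fix p q r :: real assume trans: "?Q p q" "?Q q r" "p \<le> q" "q \<le> r"
      obtain F where F: "primitive_along h ((?I \<inter> {a..b}) \<times> (?I \<inter> {p..q})) F"
        using trans(1) by blast
      obtain G where G: "primitive_along h ((?I \<inter> {a..b}) \<times> (?I \<inter> {q..r})) G"
        using trans(2) by blast
      \<comment> \<open>\<open>Bolzano\<close> ranges over arbitrary reals, hence the cuts with
        \<open>?I\<close>. The common edge is a segment or empty, and connected in both
        cases.\<close>
      have "(?I \<inter> {a..b}) \<times> (?I \<inter> {p..q}) \<inter> (?I \<inter> {a..b}) \<times> (?I \<inter> {q..r}) =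
          {max 0 a..min 1 b} \<times> (if q \<in> ?I then {q..q} else {})"
        using trans(3,4) by (auto simp: max_def min_def)
      then have "connected ((?I \<inter> {a..b}) \<times> (?I \<inter> {p..q}) \<inter> (?I \<inter> {a..b}) \<times> (?I \<inter> {q..r}))"
        by (auto intro!: connected_Times)
      moreover have "(?I \<inter> {a..b}) \<times> (?I \<inter> {p..q}) \<union> (?I \<inter> {a..b}) \<times> (?I \<inter> {q..r}) =
          (?I \<inter> {a..b}) \<times> (?I \<inter> {p..r})"
        using trans(3,4) by auto
      ultimately show "?Q p r"
        using primitive_along_union[OF F G] by (metis closed_Int closed_Times closed_atLeastAtMost)
    next
      fix x :: real
      show "\<exists>d>0. \<forall>a b. a \<le> x \<and> x \<le> b \<and> b - a < d \<longrightarrow> ?Q a b"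
        using small[OF ab] e(1) by (intro exI[of _ "e / 2"]) auto
    qed
    then show ?thesis by simp
  qed
  let ?Q = "\<lambda>p q. \<exists>F. primitive_along h ((?I \<inter> {p..q}) \<times> ?I) F"
  have "?Q 0 1"
  proof (rule Bolzano[where P = ?Q, OF zero_le_one])
    fix p q r :: real assume trans: "?Q p q" "?Q q r" "p \<le> q" "q \<le> r"
    obtain F where F: "primitive_along h ((?I \<inter> {p..q}) \<times> ?I) F" using trans(1) by blast
    obtain G where G: "primitive_along h ((?I \<inter> {q..r}) \<times> ?I) G" using trans(2) by blast
    have "(?I \<inter> {p..q}) \<times> ?I \<inter> (?I \<inter> {q..r}) \<times> ?I = (if q \<in> ?I then {q..q} else {}) \<times> ?I"
      using trans(3,4) by auto
    then have "connected ((?I \<inter> {p..q}) \<times> ?I \<inter> (?I \<inter> {q..r}) \<times> ?I)"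
      by (auto intro!: connected_Times)
    moreover have "(?I \<inter> {p..q}) \<times> ?I \<union> (?I \<inter> {q..r}) \<times> ?I = (?I \<inter> {p..r}) \<times> ?I"
      using trans(3,4) by auto
    ultimately show "?Q p r"
      using primitive_along_union[OF F G] by (metis closed_Int closed_Times closed_atLeastAtMost)
  next
    fix x :: real
    show "\<exists>d>0. \<forall>a b. a \<le> x \<and> x \<le> b \<and> b - a < d \<longrightarrow> ?Q a b"
      using strip e(1) by (intro exI[of _ "e / 2"]) auto
  qed
  then show ?thesis using that by auto
qed

text \<open>A path is an edge of the square that ignores its first coordinate, so the subdivision
  need not be repeated in dimension one.\<close>

lemma primitive_along_path:
  assumes "path p"
  obtains F where "primitive_along p {0..1} F"
proof -
  have cont: "continuous_on ({0..1::real} \<times> {0..1}) (p \<circ> snd)"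
    unfolding comp_def
    by (rule continuous_on_compose2[OF assms[unfolded path_def]])
      (use continuous_on_snd[OF continuous_on_id] in auto)
  obtain F where F: "primitive_along (p \<circ> snd) ({0..1::real} \<times> {0..1}) F"
    using primitive_along_square[OF cont] .
  have "primitive_along ((p \<circ> snd) \<circ> Pair (0::real)) {0..1} (F \<circ> Pair 0)"
    by (rule primitive_along_compose[OF F]) (auto intro!: continuous_intros)
  then show ?thesis using that by (simp add: comp_def)
qed

text \<open>Continue over the square of a homotopy contracting the loop. The edge
  \<open>s = 1\<close> is a constant path and contributes no increment; the edges
  \<open>t = 0\<close> and \<open>t = 1\<close> contribute equally, so the edge
  \<open>s = 0\<close>, which is \<open>p\<close>, has increment zero.\<close>

lemma primitive_along_loop:
  assumes sc: "simply_connected (UNIV :: 'a set)"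
    and p: "path p" "pathfinish p = pathstart p" and F: "primitive_along p {0..1} F"
  shows "F 1 = F 0"
proof -
  let ?I = "{0..1::real}"
  have "homotopic_loops UNIV p (\<lambda>_. pathstart p)"
    using sc p unfolding simply_connected_def
    by (auto simp: path_def pathfinish_def pathstart_def path_image_def)
  then obtain h where h: "continuous_on (?I \<times> ?I) h" "\<forall>t\<in>?I. h (0, t) = p t"
      "\<forall>t\<in>?I. h (1, t) = pathstart p" "\<forall>s\<in>?I. h (s, 1) = h (s, 0)"
    unfolding homotopic_loops by (auto simp: pathfinish_def pathstart_def)
  obtain H where H: "primitive_along h (?I \<times> ?I) H" using primitive_along_square[OF h(1)] .
  have slice: "primitive_along (h \<circ> Pair s) ?I (H \<circ> Pair s)" if "s \<in> ?I" for s
    by (rule primitive_along_compose[OF H]) (use that in \<open>auto intro!: continuous_intros\<close>)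
  have cong: "primitive_along q ?I K" if "primitive_along q' ?I K" "\<And>t. t \<in> ?I \<Longrightarrow> q' t = q t"
    for q q' K
    using that by (simp add: primitive_along_def cong: imp_cong)
  have end0: "primitive_along (h \<circ> (\<lambda>s. (s, 0))) ?I (H \<circ> (\<lambda>s. (s, 0)))"
    and end1: "primitive_along (h \<circ> (\<lambda>s. (s, 1))) ?I (H \<circ> (\<lambda>s. (s, 1)))"
    by (rule primitive_along_compose[OF H]; auto intro!: continuous_intros)+
  \<comment> \<open>The homotopy is free and its base point may move, but both edges trace the same
    curve, so \<open>H\<close> on either is a primitive along it.\<close>
  have "primitive_along (h \<circ> (\<lambda>s. (s, 0))) ?I (H \<circ> (\<lambda>s. (s, 1)))"
    by (rule cong[OF end1]) (use h(4) in auto)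
  from primitive_along_diff_eq[OF this end0, of 0 1]
  have "H (1, 1) - H (0, 1) = H (1, 0) - H (0, 0)" by auto
  moreover have "H (1, 1) = H (1, 0)"
  proof -
    have 1: "primitive_along (\<lambda>_. pathstart p) ?I (H \<circ> Pair 1)"
      by (rule cong[OF slice[of 1]]) (use h(3) in auto)
    have 2: "primitive_along (\<lambda>_. pathstart p) ?I (\<lambda>_. 0)"
      by (auto simp: primitive_along_def)
    show ?thesis using primitive_along_diff_eq[OF 1 2, of 0 1] by simp
  qed
  moreover have "H (0, 1) - H (0, 0) = F 1 - F 0"
  proof -
    have "primitive_along p ?I (H \<circ> Pair 0)"
      by (rule cong[OF slice[of 0]]) (use h(2) in auto)
    from primitive_along_diff_eq[OF this F, of 0 1] show ?thesis by simp
  qed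
  ultimately show ?thesis by simp
qed

text \<open>The value at \<open>x\<close> is the increment along a chosen path from a base point.
  Two paths with common ends form a loop, whose increment vanishes, so the choice does not
  matter.\<close>

theorem primitive_along_id:
  assumes sc: "simply_connected (UNIV :: 'a set)"
  obtains f where "primitive_along id UNIV f"
proof -
  let ?I = "{0..1::real}"
  have conn: "\<exists>p. path p \<and> pathstart p = a \<and> pathfinish p = b" for a b :: 'a
  proof -
    \<comment> \<open>Constant loops at \<open>a\<close> and \<open>b\<close> are freely homotopic;
      the track of the base point is a path joining them.\<close>
    have "homotopic_loops UNIV (\<lambda>_::real. a) (\<lambda>_. b)"
      using sc unfolding simply_connected_def
      by (auto simp: path_def pathfinish_def pathstart_def path_image_def)
    then obtain h where h: "continuous_on (?I \<times> ?I) h" "\<forall>t\<in>?I. h (0, t) = a"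
        "\<forall>t\<in>?I. h (1, t) = b"
      unfolding homotopic_loops by auto
    have "continuous_on ?I (h \<circ> (\<lambda>s. (s, 0)))"
      unfolding comp_def
      by (rule continuous_on_compose2[OF h(1)]) (auto intro!: continuous_intros)
    then show ?thesis using h
      by (intro exI[of _ "h \<circ> (\<lambda>s. (s, 0))"]) (auto simp: path_def pathstart_def pathfinish_def)
  qed
  have half: "primitive_along q ?I (\<lambda>t. H (a + b * t))"
    if "primitive_along p ?I H" "\<And>t. t \<in> ?I \<Longrightarrow> a + b * t \<in> ?I \<and> p (a + b * t) = q t"
    for p q H a b
  proof -
    have "primitive_along (p \<circ> (\<lambda>t. a + b * t)) ?I (H \<circ> (\<lambda>t. a + b * t))"
      by (rule primitive_along_compose[OF that(1)]) (use that(2) in \<open>auto intro!: continuous_intros\<close>)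
    then show ?thesis using that(2) by (simp add: primitive_along_def cong: imp_cong)
  qed
  have indep: "G 1 - G 0 = F 1 - F 0"
    if p: "path p" "path q" "pathstart p = pathstart q" "pathfinish p = pathfinish q"
      and F: "primitive_along p ?I F" and G: "primitive_along q ?I G" for p q F G
  proof -
    let ?l = "p +++ reversepath q"
    have l: "path ?l" "pathfinish ?l = pathstart ?l" using p by auto
    obtain H where H: "primitive_along ?l ?I H" using primitive_along_path[OF l(1)] .
    have H01: "H 1 = H 0" by (rule primitive_along_loop[OF sc l H])
    have 1: "primitive_along p ?I (\<lambda>t. H (0 + 1 / 2 * t))"
      by (rule half[OF H]) (auto simp: joinpaths_def)
    \<comment> \<open>The negative slope traverses the second half of the loop backwards, which
      undoes the reversal of \<open>q\<close>.\<close>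
    have 2: "primitive_along q ?I (\<lambda>t. H (1 + - 1 / 2 * t))"
      using p(4) by (intro half[OF H]) (auto simp: joinpaths_def reversepath_def pathfinish_def
          algebra_simps)
    show ?thesis
      using primitive_along_diff_eq[OF 1 F, of 0 1] primitive_along_diff_eq[OF 2 G, of 0 1] H01
      by simp
  qed
  define x0 :: 'a where "x0 = undefined"
  define \<gamma> where "\<gamma> x = (SOME p. path p \<and> pathstart p = x0 \<and> pathfinish p = x)" for x
  have \<gamma>: "path (\<gamma> x)" "pathstart (\<gamma> x) = x0" "pathfinish (\<gamma> x) = x" for x
    using someI_ex[OF conn[of x0 x]] by (auto simp: \<gamma>_def)
  define \<Phi> where "\<Phi> x = (SOME F. primitive_along (\<gamma> x) ?I F)" for x
  have \<Phi>: "primitive_along (\<gamma> x) ?I (\<Phi> x)" for x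
    using primitive_along_path[OF \<gamma>(1)[of x]] someI_ex unfolding \<Phi>_def by metis
  define f where "f x = \<Phi> x 1 - \<Phi> x 0" for x
  \<comment> \<open>Extending the path to \<open>x\<close> by a path inside \<open>U\<close> adds
    exactly the increment of \<open>u\<close>. This is where path-connected domains are
    used.\<close>
  have "f y - f x = u y - u x" if U: "(U, u) \<in> P" "x \<in> U" "y \<in> U" for U u x y
  proof -
    obtain q where q: "path q" "path_image q \<subseteq> U" "pathstart q = x" "pathfinish q = y"
      using path_connected_dom[OF U(1)] U(2,3) unfolding path_connected_def by blast
    let ?l = "\<gamma> x +++ q"
    have l: "path ?l" "pathstart ?l = x0" "pathfinish ?l = y" using \<gamma>[of x] q by auto
    obtain H where H: "primitive_along ?l ?I H" using primitive_along_path[OF l(1)] .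
    have 1: "primitive_along (\<gamma> x) ?I (\<lambda>t. H (0 + 1 / 2 * t))"
      by (rule half[OF H]) (auto simp: joinpaths_def)
    have 2: "primitive_along q ?I (\<lambda>t. H (1 / 2 + 1 / 2 * t))"
      using \<gamma>(3)[of x] q(3)
      by (intro half[OF H]) (auto simp: joinpaths_def pathfinish_def pathstart_def)
    have 3: "primitive_along q ?I (u \<circ> q)"
      using q by (intro primitive_along_local[OF _ _ U(1)]) (auto simp: path_def path_image_def)
    have "f y = H 1 - H 0" unfolding f_def
      by (rule indep[OF l(1) \<gamma>(1) _ _ H \<Phi>]) (simp_all add: q \<gamma>)
    moreover have "f x = H (1 / 2) - H 0"
      using primitive_along_diff_eq[OF 1 \<Phi>[of x], of 0 1] by (simp add: f_def)
    moreover have "u y - u x = H 1 - H (1 / 2)"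
      using primitive_along_diff_eq[OF 2 3, of 0 1] q by (simp add: pathfinish_def pathstart_def)
    ultimately show ?thesis by simp
  qed
  then have "\<forall>\<^sub>F y in nhds x. f y - f x = u y - u x" if "(U, u) \<in> P" "x \<in> U" for U u x
    using eventually_nhds_in_open[OF open_dom[OF that(1)] that(2)] that
    by (auto elim!: eventually_mono)
  then have "primitive_along id UNIV f"
    unfolding primitive_along_def by auto
  then show ?thesis by (rule that)
qed

end

section \<open>Closed one-forms\<close>

text \<open>The Poincare lemma on a convex set: \<open>u x\<close> is the integral of the form along
  the segment from \<open>z0\<close> to \<open>x\<close>, differentiated under the integral
  sign.\<close>

lemma closed_one_form_primitive:
  fixes \<theta> :: "'e::euclidean_space \<Rightarrow> 'e \<Rightarrow> real"
  assumes B: "convex B" "open B" "z0 \<in> B"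
    and lin: "\<And>z. z \<in> B \<Longrightarrow> linear (\<theta> z)"
    and der: "\<And>z v. z \<in> B \<Longrightarrow> ((\<lambda>y. \<theta> y v) has_derivative \<theta>' z v) (at z)"
    and cont: "\<And>v w. continuous_on B (\<lambda>z. \<theta>' z v w)"
    and sym: "\<And>z v w. z \<in> B \<Longrightarrow> \<theta>' z v w = \<theta>' z w v"
  obtains u where "\<And>z. z \<in> B \<Longrightarrow> (u has_derivative \<theta> z) (at z)"
proof -
  define p where "p x t = z0 + t *\<^sub>R (x - z0)" for x :: 'e and t :: real
  have pB: "p x t \<in> B" if "x \<in> B" "t \<in> {0..1}" for x t
  proof -
    have "(1 - t) *\<^sub>R z0 + t *\<^sub>R x \<in> B"
      using convexD[OF B(1) B(3) that(1), of "1 - t" t] that(2) by auto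
    then show ?thesis by (simp add: p_def algebra_simps)
  qed
  have \<theta>cont: "continuous_on B (\<lambda>z. \<theta> z v)" for v
    using has_derivative_continuous[OF der] B(2) continuous_at_imp_continuous_on by blast
  have lin': "linear (\<theta>' z v)" if "z \<in> B" for z v
    using has_derivative_linear[OF der[OF that]] .
  have expand: "L v = (\<Sum>b\<in>Basis. (v \<bullet> b) * L b)" if "linear L" for L :: "'e \<Rightarrow> real" and v
    using linear_sum[OF that, of "\<lambda>b. (v \<bullet> b) *\<^sub>R b" Basis] linear_scale[OF that]
    by (simp add: euclidean_representation)
  define f where "f x t = (\<Sum>b\<in>Basis. ((x - z0) \<bullet> b) * \<theta> (p x t) b)" for x t
  \<comment> \<open>The derivative of the integrand in direction \<open>w\<close>, already rewritten
    with the symmetry of \<open>\<theta>'\<close>. In this shape it is the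
    \<open>t\<close>-derivative of \<open>t * \<theta> (p x t) w\<close>, so its integral is
    \<open>\<theta> x w\<close>. The sums over \<open>Basis\<close> occur because regularity is
    assumed only for fixed vectors.\<close>
  define G where "G x t w = \<theta> (p x t) w + t * (\<Sum>b\<in>Basis. ((x - z0) \<bullet> b) * \<theta>' (p x t) w b)"
    for x t w
  have G_alt: "G x t w = (\<Sum>b\<in>Basis. ((x - z0) \<bullet> b) * \<theta>' (p x t) b (t *\<^sub>R w) + (w \<bullet> b) * \<theta> (p x t) b)"
    if "x \<in> B" "t \<in> {0..1}" for x t w
    using linear_scale[OF lin'[OF pB[OF that]]] expand[OF lin[OF pB[OF that]], of w]
    by (simp add: G_def sum.distrib sum_subtractf sum_distrib_left sym[OF pB[OF that], of _ w] algebra_simps)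
  have fder: "((\<lambda>x. f x t) has_derivative G x t) (at x)" if xt: "x \<in> B" "t \<in> {0..1}" for x t
  proof -
    have d: "((\<lambda>y. \<theta> (p y t) b) has_derivative (\<lambda>w. \<theta>' (p x t) b (t *\<^sub>R w))) (at x)" for b
    proof -
      have "((\<lambda>y. p y t) has_derivative (\<lambda>w. t *\<^sub>R w)) (at x)"
        unfolding p_def by (auto intro!: derivative_eq_intros)
      from has_derivative_compose[OF this der[OF pB[OF xt]]] show ?thesis .
    qed
    have "((\<lambda>x. f x t) has_derivative (\<lambda>w. \<Sum>b\<in>Basis.
        ((x - z0) \<bullet> b) * \<theta>' (p x t) b (t *\<^sub>R w) + (w \<bullet> b) * \<theta> (p x t) b)) (at x)"
      unfolding f_def by (auto intro!: derivative_eq_intros d)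
    then show ?thesis using G_alt[OF xt] by presburger
  qed
  have Glin: "bounded_linear (G x t)" if "x \<in> B" "t \<in> {0..1}" for x t
    using has_derivative_bounded_linear[OF fder[OF that]] .
  have pc: "continuous_on (B \<times> {0..1}) (\<lambda>(x, t). p x t)"
    unfolding p_def case_prod_beta by (intro continuous_intros)
  have comp: "continuous_on (B \<times> {0..1}) (\<lambda>(x, t). k (p x t))" if "continuous_on B k"
    for k :: "'e \<Rightarrow> real"
  proof -
    have "continuous_on (B \<times> {0..1}) (\<lambda>z. k (case z of (x, t) \<Rightarrow> p x t))"
      by (rule continuous_on_compose2[OF that pc]) (use pB in auto)
    then show ?thesis by (simp add: case_prod_beta)
  qed
  have Gcont: "continuous_on (B \<times> {0..1}) (\<lambda>(x, t). G x t w)" for w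
    using comp[OF \<theta>cont] comp[OF cont] unfolding G_def case_prod_beta by (intro continuous_intros)
  have fcont: "continuous_on {0..1} (f x)" if "x \<in> B" for x
  proof -
    have "continuous_on {0..1} (\<lambda>t. \<theta> (p x t) b)" for b
    proof (rule continuous_on_compose2[OF \<theta>cont[of b]])
      show "continuous_on {0..1} (p x)" unfolding p_def by (intro continuous_intros)
    qed (use pB that in auto)
    then show ?thesis unfolding f_def by (intro continuous_intros)
  qed
  define u where "u x = integral {0..1} (f x)" for x
  have "(u has_derivative \<theta> x) (at x)" if x: "x \<in> B" for x
  proof -
    \<comment> \<open>\<open>leibniz_rule\<close> wants a jointly continuous family of bounded
      linear operators; in finite dimension continuity can be checked on each vector.\<close>
    have BG: "blinfun_apply (Blinfun (G x t)) = G x t" if "x \<in> B" "t \<in> {0..1}" for x t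
      using Glin[OF that] by (rule bounded_linear_Blinfun_apply)
    have cont_B: "continuous_on (B \<times> cbox 0 1) (\<lambda>(x, t). Blinfun (G x t))"
    proof (rule continuous_on_blinfun_componentwise)
      fix i :: 'e
      have "continuous_on (B \<times> {0..1}) (\<lambda>z. blinfun_apply (case z of (x, t) \<Rightarrow> Blinfun (G x t)) i) \<longleftrightarrow>
          continuous_on (B \<times> {0..1}) (\<lambda>(x, t). G x t i)"
        by (rule continuous_on_cong) (auto simp: BG)
      then show "continuous_on (B \<times> cbox 0 1)
          (\<lambda>z. blinfun_apply (case z of (x, t) \<Rightarrow> Blinfun (G x t)) i)"
        using Gcont by simp
    qed
    have "(u has_derivative blinfun_apply (integral (cbox 0 1) (\<lambda>t. Blinfun (G x t)))) (at x within B)"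
      unfolding u_def cbox_interval[symmetric]
    proof (rule leibniz_rule[OF _ _ cont_B x B(1)])
      fix x t assume "x \<in> B" "t \<in> cbox 0 (1::real)"
      then show "((\<lambda>x. f x t) has_derivative blinfun_apply (Blinfun (G x t))) (at x within B)"
        using fder[THEN has_derivative_at_withinI] by (simp add: BG)
    next
      fix x assume "x \<in> B"
      then show "f x integrable_on cbox 0 1" using fcont integrable_continuous_interval by auto
    qed
    moreover have "blinfun_apply (integral (cbox 0 1) (\<lambda>t. Blinfun (G x t))) = \<theta> x"
    proof (rule ext)
      fix w
      have 1: "continuous_on (cbox 0 1) (\<lambda>t. case (x, t) of (x, t) \<Rightarrow> Blinfun (G x t))"
        by (rule continuous_on_compose2[OF cont_B]) (use x in \<open>auto intro!: continuous_intros\<close>)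
      then have "(\<lambda>t. Blinfun (G x t)) integrable_on cbox 0 1"
        by (intro integrable_continuous) simp
      then have "blinfun_apply (integral (cbox 0 1) (\<lambda>t. Blinfun (G x t))) w =
          integral {0..1} (\<lambda>t. blinfun_apply (Blinfun (G x t)) w)"
        by (simp add: blinfun_apply_integral)
      also have "\<dots> = integral {0..1} (\<lambda>t. G x t w)"
        by (rule Henstock_Kurzweil_Integration.integral_cong) (simp add: BG x)
      also have "\<dots> = 1 * \<theta> (p x 1) w - 0 * \<theta> (p x 0) w"
      proof (rule integral_unique, rule fundamental_theorem_of_calculus)
        fix t :: real assume t: "t \<in> {0..1}"
        have "(p x has_derivative (\<lambda>s. s *\<^sub>R (x - z0))) (at t)"
          unfolding p_def by (auto intro!: derivative_eq_intros)
        from has_derivative_compose[OF this der[OF pB[OF x t], of w]]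
        have "((\<lambda>t. \<theta> (p x t) w) has_derivative (\<lambda>s. s * \<theta>' (p x t) w (x - z0))) (at t)"
          by (simp add: linear_scale[OF lin'[OF pB[OF x t]]])
        then have "((\<lambda>t. \<theta> (p x t) w) has_real_derivative \<theta>' (p x t) w (x - z0)) (at t)"
          by (rule has_derivative_imp_has_field_derivative) simp
        then have "((\<lambda>t. t * \<theta> (p x t) w) has_real_derivative
            \<theta> (p x t) w + t * \<theta>' (p x t) w (x - z0)) (at t)"
          by (auto intro!: derivative_eq_intros)
        also have "\<theta> (p x t) w + t * \<theta>' (p x t) w (x - z0) = G x t w"
          using expand[OF lin'[OF pB[OF x t], of w], of "x - z0"] by (simp add: G_def)
        finally show "((\<lambda>t. t * \<theta> (p x t) w) has_vector_derivative G x t w) (at t within {0..1})"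
          by (simp add: has_real_derivative_iff_has_vector_derivative has_vector_derivative_at_within)
      qed simp
      also have "\<dots> = \<theta> x w" by (simp add: p_def)
      finally show "blinfun_apply (integral (cbox 0 1) (\<lambda>t. Blinfun (G x t))) w = \<theta> x w" .
    qed
    ultimately have "(u has_derivative \<theta> x) (at x within B)" by simp
    then show ?thesis using at_within_open[OF x B(2)] by simp
  qed
  then show ?thesis by (rule that)
qed

section \<open>Calculus of smooth maps and the real form of \<open>dc\<close>\<close>

lemma smooth_on_continuous_on: "smooth_on f S \<Longrightarrow> continuous_on S f"
  unfolding smooth_on_def by (metis Ck_on.simps(1))

lemma smooth_on_has_derivative:
  "smooth_on f S \<Longrightarrow> x \<in> S \<Longrightarrow> (f has_derivative frechet_derivative f (at x)) (at x)"
  unfolding smooth_on_def by (metis Ck_on.simps(2) frechet_derivative_works)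

lemma smooth_on_frechet_derivative:
  "smooth_on f S \<Longrightarrow> smooth_on (\<lambda>x. frechet_derivative f (at x) v) S"
  unfolding smooth_on_def by (metis Ck_on.simps(2))

lemma Ck_on_cong:
  assumes "open S" "\<And>x. x \<in> S \<Longrightarrow> f x = g x" "Ck_on k f S"
  shows "Ck_on k g S"
  using assms(2,3)
proof (induction k arbitrary: f g)
  case 0
  then show ?case using continuous_on_cong[OF refl, of S f g] by simp
next
  case (Suc k)
  have d: "(g has_derivative frechet_derivative f (at x)) (at x)" if "x \<in> S" for x
  proof (rule has_derivative_transform_within_open[OF _ assms(1) that])
    show "(f has_derivative frechet_derivative f (at x)) (at x)"
      using Suc.prems(2) that by (simp add: frechet_derivative_works)
  qed (use Suc.prems(1) in auto)
  have "Ck_on k (\<lambda>x. frechet_derivative g (at x) v) S" for v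
    by (rule Suc.IH[of "\<lambda>x. frechet_derivative f (at x) v"])
      (use Suc.prems(2) frechet_derivative_at[OF d] in auto)
  then show ?case using d by (auto simp: differentiable_def)
qed

lemma Ck_on_lincomb:
  assumes "open S" "Ck_on k f S" "Ck_on k g S"
  shows "Ck_on k (\<lambda>x. a *\<^sub>R f x + b *\<^sub>R g x) S"
  using assms(2,3)
proof (induction k arbitrary: f g)
  case 0
  then show ?case by (auto intro!: continuous_intros)
next
  case (Suc k)
  have d: "((\<lambda>x. a *\<^sub>R f x + b *\<^sub>R g x) has_derivative
      (\<lambda>v. a *\<^sub>R frechet_derivative f (at x) v + b *\<^sub>R frechet_derivative g (at x) v)) (at x)"
    if "x \<in> S" for x
    using Suc.prems that
    by (intro derivative_intros) (auto simp: frechet_derivative_works)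
  have "Ck_on k (\<lambda>x. frechet_derivative (\<lambda>x. a *\<^sub>R f x + b *\<^sub>R g x) (at x) v) S" for v
    by (rule Ck_on_cong[OF assms(1) _ Suc.IH[of "\<lambda>x. frechet_derivative f (at x) v"
          "\<lambda>x. frechet_derivative g (at x) v"]])
      (use Suc.prems fun_cong[OF frechet_derivative_at[OF d]] in auto)
  then show ?case using d by (auto simp: differentiable_def)
qed

lemma smooth_on_cong:
  "open S \<Longrightarrow> (\<And>x. x \<in> S \<Longrightarrow> f x = g x) \<Longrightarrow> smooth_on f S \<Longrightarrow> smooth_on g S"
  unfolding smooth_on_def using Ck_on_cong by blast

lemma smooth_on_lincomb:
  "open S \<Longrightarrow> smooth_on f S \<Longrightarrow> smooth_on g S \<Longrightarrow> smooth_on (\<lambda>x. a *\<^sub>R f x + b *\<^sub>R g x) S"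
  unfolding smooth_on_def using Ck_on_lincomb by blast

text \<open>Expanding \<open>D\<close> in the real basis \<open>axis \<alpha> 1\<close>,
  \<open>axis \<alpha> \<i>\<close> turns the Wirtinger formula into \<open>- dg o J / 2\<close>.
  Later arguments about \<open>dc\<close> can then work with real derivatives.\<close>

lemma dc_eq_derivative:
  fixes c :: "('a, 'n::finite) chart"
  assumes "((g \<circ> chart_inv c) has_derivative D) (at z)"
  shows "dc g c z v = - D (\<i> *s v) / 2"
proof -
  have fd: "frechet_derivative (g \<circ> chart_inv c) (at z) = D"
    using frechet_derivative_at[OF assms] by simp
  have lin: "linear D" using has_derivative_linear[OF assms] .
  have ex: "w = (\<Sum>\<alpha>\<in>UNIV. Re (w $ \<alpha>) *\<^sub>R axis \<alpha> 1 + Im (w $ \<alpha>) *\<^sub>R axis \<alpha> \<i>)"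
    for w :: "complex ^ 'n"
  proof -
    have "(\<Sum>\<alpha>\<in>UNIV. Re (w $ \<alpha>) *\<^sub>R axis \<alpha> 1 + Im (w $ \<alpha>) *\<^sub>R axis \<alpha> \<i>) =
        (\<Sum>\<alpha>\<in>UNIV. w $ \<alpha> *s axis \<alpha> 1)"
      by (rule sum.cong) (auto simp: vec_eq_iff axis_def complex_eq_iff)
    then show ?thesis by (simp add: basis_expansion)
  qed
  have D: "D w = (\<Sum>\<alpha>\<in>UNIV. Re (w $ \<alpha>) * D (axis \<alpha> 1) + Im (w $ \<alpha>) * D (axis \<alpha> \<i>))" for w
    by (subst ex[of w]) (simp add: linear_sum[OF lin] linear_add[OF lin] linear_scale[OF lin])
  have "dc g c z v = (\<Sum>\<alpha>\<in>UNIV. - (Re ((\<i> *s v) $ \<alpha>) * D (axis \<alpha> 1) +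
      Im ((\<i> *s v) $ \<alpha>) * D (axis \<alpha> \<i>)) / 2)"
    by (simp add: dc_Im del_def wirtinger_def fd Im_divide_numeral algebra_simps
        add_divide_distrib diff_divide_distrib)
  then show ?thesis by (simp add: D[of "\<i> *s v"] sum_divide_distrib flip: sum_negf)
qed

section \<open>One-forms on a manifold and exactness of closed ones\<close>

locale atlas =
  fixes A :: "('a::{t2_space, second_countable_topology}, 'n::finite) chart set"
  assumes manifold: "complex_manifold A"
begin

lemma is_chart: "c \<in> A \<Longrightarrow> is_chart c"
  using manifold unfolding complex_manifold_def by blast

lemma chart_inv_chart: "c \<in> A \<Longrightarrow> x \<in> fst c \<Longrightarrow> chart_inv c (snd c x) = x"
  using is_chart unfolding is_chart_def by (meson homeomorphism_apply1)

lemma chart_open: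
  assumes c: "c \<in> A"
  shows "open (fst c)" "open (chart_image c)"
    and "open V \<Longrightarrow> open (fst c \<inter> snd c -` V)"
    and "open W \<Longrightarrow> open (snd c ` (fst c \<inter> W))"
proof -
  have o: "open (fst c)" "open (chart_image c)"
    and h: "homeomorphism (fst c) (chart_image c) (snd c) (chart_inv c)"
    using is_chart[OF c] unfolding is_chart_def by auto
  show "open (fst c)" "open (chart_image c)" by fact+
  show "open V \<Longrightarrow> open (fst c \<inter> snd c -` V)"
    using continuous_open_preimage[OF homeomorphism_cont1[OF h] o(1)] .
  have "snd c ` (fst c \<inter> W) = chart_image c \<inter> chart_inv c -` W"
    using chart_inv_chart[OF c] by (auto simp: image_iff)
  then show "open W \<Longrightarrow> open (snd c ` (fst c \<inter> W))"
    using continuous_open_preimage[OF homeomorphism_cont2[OF h] o(2)] by simp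
qed

lemma chart_inv_mem: "z \<in> chart_image c \<Longrightarrow> chart_inv c z \<in> fst c \<and> snd c (chart_inv c z) = z"
  by (simp add: inv_into_into f_inv_into_f)

lemma chart_inv_continuous: "c \<in> A \<Longrightarrow> continuous_on (chart_image c) (chart_inv c)"
  using is_chart unfolding is_chart_def by (meson homeomorphism_cont2)

lemma transition_has_derivative:
  assumes "c \<in> A" "d \<in> A" "x \<in> fst c" "x \<in> fst d"
  defines "D \<equiv> frechet_derivative (transition c d) (at (snd c x))"
  shows "(transition c d has_derivative D) (at (snd c x))" "D (a *s v) = a *s D v"
proof -
  have "holomorphic_map_on (transition c d) (snd c ` (fst c \<inter> fst d))"
    using manifold assms(1,2) unfolding complex_manifold_def by blast
  then obtain D' where D': "(transition c d has_derivative D') (at (snd c x))"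
      "\<And>a v. D' (a *s v) = a *s D' v"
    using assms(3,4) unfolding holomorphic_map_on_def by blast
  have "D = D'" using frechet_derivative_at[OF D'(1)] by (simp add: D_def)
  then show "(transition c d has_derivative D) (at (snd c x))" "D (a *s v) = a *s D v"
    using D' by auto
qed

lemma has_derivative_chart_change:
  assumes c: "c \<in> A" and d: "d \<in> A" and x: "x \<in> fst c" "x \<in> fst d"
    and L: "((h \<circ> chart_inv c) has_derivative L) (at (snd c x))"
  shows "((h \<circ> chart_inv d) has_derivative
    (\<lambda>v. L (frechet_derivative (transition d c) (at (snd d x)) v))) (at (snd d x))"
proof (rule has_derivative_transform_within_open)
  let ?V = "snd d ` (fst d \<inter> fst c)"
  show "open ?V" using chart_open(4)[OF d chart_open(1)[OF c]] .
  show "snd d x \<in> ?V" using x by blast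
  have "transition d c (snd d x) = snd c x" using chart_inv_chart[OF d x(2)] by simp
  then show "((h \<circ> chart_inv c \<circ> transition d c) has_derivative
      (\<lambda>v. L (frechet_derivative (transition d c) (at (snd d x)) v))) (at (snd d x))"
    using has_derivative_compose[OF transition_has_derivative(1)[OF d c x(2,1)], of "h \<circ> chart_inv c" L] L
    by (simp add: comp_def)
  fix y assume "y \<in> ?V"
  then show "(h \<circ> chart_inv c \<circ> transition d c) y = (h \<circ> chart_inv d) y"
    using chart_inv_chart[OF c] chart_inv_chart[OF d] by auto
qed

lemma smooth_function_has_derivative:
  assumes "smooth_function A g" "c \<in> A" "z \<in> chart_image c"
  shows "((g \<circ> chart_inv c) has_derivative frechet_derivative (g \<circ> chart_inv c) (at z)) (at z)"
  using assms smooth_on_has_derivative unfolding smooth_function_def by blast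

lemma one_form_dc:
  assumes g: "smooth_function A g"
  shows "one_form A (dc g)"
  unfolding one_form_def
proof (intro conjI ballI allI)
  fix c z assume c: "c \<in> A" and z: "z \<in> chart_image c"
  let ?D = "frechet_derivative (g \<circ> chart_inv c) (at z)"
  have lin: "linear ?D" using has_derivative_linear[OF smooth_function_has_derivative[OF g c z]] .
  have "\<i> *s (v + w) = \<i> *s v + \<i> *s w" "\<i> *s (r *\<^sub>R v) = r *\<^sub>R (\<i> *s v)" for v w :: "complex ^ 'n" and r
    by (simp_all add: vec_eq_iff algebra_simps)
  then show "linear (dc g c z)"
    by (intro linearI) (simp_all add: dc_eq_derivative[OF smooth_function_has_derivative[OF g c z]]
        linear_add[OF lin] linear_scale[OF lin] add_divide_distrib)
next
  fix c v assume c: "c \<in> A"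
  have 1: "smooth_on (\<lambda>z. frechet_derivative (g \<circ> chart_inv c) (at z) (\<i> *s v)) (chart_image c)"
    using g c by (intro smooth_on_frechet_derivative) (auto simp: smooth_function_def)
  show "smooth_on (\<lambda>z. dc g c z v) (chart_image c)"
    by (rule smooth_on_cong[OF chart_open(2)[OF c] _
          smooth_on_lincomb[OF chart_open(2)[OF c] 1 1, of "- 1 / 2" 0]])
      (simp add: dc_eq_derivative[OF smooth_function_has_derivative[OF g c]])
next
  fix c d x v assume c: "c \<in> A" and d: "d \<in> A" and x: "x \<in> fst c \<inter> fst d"
  let ?T = "frechet_derivative (transition c d) (at (snd c x))"
  let ?L = "frechet_derivative (g \<circ> chart_inv d) (at (snd d x))"
  have L: "((g \<circ> chart_inv d) has_derivative ?L) (at (snd d x))"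
    using smooth_function_has_derivative[OF g d] x by blast
  have "dc g c (snd c x) v = - ?L (?T (\<i> *s v)) / 2"
    using has_derivative_chart_change[OF d c _ _ L] x dc_eq_derivative by blast
  \<comment> \<open>Holomorphy of the transition enters here: its derivative commutes with
    multiplication by \<open>\<i>\<close>.\<close>
  also have "?T (\<i> *s v) = \<i> *s ?T v" using transition_has_derivative(2)[OF c d] x by blast
  also have "- ?L (\<i> *s ?T v) / 2 = dc g d (snd d x) (?T v)" using dc_eq_derivative[OF L] by simp
  finally show "dc g c (snd c x) v = dc g d (snd d x) (?T v)" .
qed

lemma one_formD:
  assumes "one_form A \<eta>" "c \<in> A"
  shows "z \<in> chart_image c \<Longrightarrow> linear (\<eta> c z)"
    and "smooth_on (\<lambda>z. \<eta> c z v) (chart_image c)"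
    and "\<lbrakk>d \<in> A; x \<in> fst c; x \<in> fst d\<rbrakk> \<Longrightarrow> \<eta> c (snd c x) v =
      \<eta> d (snd d x) (frechet_derivative (transition c d) (at (snd c x)) v)"
  using assms unfolding one_form_def by blast+

lemma one_form_diff:
  assumes \<eta>: "one_form A \<eta>" and \<zeta>: "one_form A \<zeta>"
  shows "one_form A (\<lambda>c z v. \<eta> c z v - \<zeta> c z v)"
  unfolding one_form_def
proof (intro conjI ballI allI)
  fix c z assume "c \<in> A" "z \<in> chart_image c"
  then show "linear (\<lambda>v. \<eta> c z v - \<zeta> c z v)"
    by (intro linear_compose_sub one_formD(1)[OF \<eta>] one_formD(1)[OF \<zeta>])
next
  fix c v assume c: "c \<in> A"
  show "smooth_on (\<lambda>z. \<eta> c z v - \<zeta> c z v) (chart_image c)"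
    using smooth_on_lincomb[OF chart_open(2)[OF c] one_formD(2)[OF \<eta> c] one_formD(2)[OF \<zeta> c],
        of 1 v "- 1" v] by simp
next
  fix c d x v assume "c \<in> A" "d \<in> A" "x \<in> fst c \<inter> fst d"
  then show "\<eta> c (snd c x) v - \<zeta> c (snd c x) v =
      \<eta> d (snd d x) (frechet_derivative (transition c d) (at (snd c x)) v) -
      \<zeta> d (snd d x) (frechet_derivative (transition c d) (at (snd c x)) v)"
    using one_formD(3)[OF \<eta>, of c d x v] one_formD(3)[OF \<zeta>, of c d x v] by simp
qed

lemma ext_deriv1_diff:
  assumes "one_form A \<eta>" "one_form A \<zeta>" "c \<in> A" "z \<in> chart_image c"
  shows "ext_deriv1 (\<lambda>c z v. \<eta> c z v - \<zeta> c z v) c z v w = ext_deriv1 \<eta> c z v w - ext_deriv1 \<zeta> c z v w"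
proof -
  have "((\<lambda>z. \<eta> c z v - \<zeta> c z v) has_derivative (\<lambda>w. frechet_derivative (\<lambda>z. \<eta> c z v) (at z) w -
      frechet_derivative (\<lambda>z. \<zeta> c z v) (at z) w)) (at z)" for v
    by (intro has_derivative_diff smooth_on_has_derivative[OF _ assms(4)] one_formD(2) assms)
  note fd = fun_cong[OF frechet_derivative_at[OF this], symmetric]
  show ?thesis by (simp add: ext_deriv1_def fd)
qed

text \<open>Coordinate balls carry primitives by the Poincare lemma, and simple connectedness glues
  them. Membership in \<open>P\<close> is tested in one chart; the transformation law of
  \<open>\<theta>\<close> carries it to every other in \<open>any_chart\<close>.\<close>

theorem closed_one_form_exact:
  assumes sc: "simply_connected (UNIV :: 'a set)" and \<theta>: "one_form A \<theta>"
    and closed: "\<And>c z v w. c \<in> A \<Longrightarrow> z \<in> chart_image c \<Longrightarrow> ext_deriv1 \<theta> c z v w = 0"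
  obtains f where
    "\<forall>c\<in>A. \<forall>z\<in>chart_image c. ((f \<circ> chart_inv c) has_derivative \<theta> c z) (at z)"
proof -
  define prim where "prim c U u \<longleftrightarrow> c \<in> A \<and> U \<subseteq> fst c \<and>
      (\<forall>x\<in>U. ((u \<circ> chart_inv c) has_derivative \<theta> c (snd c x)) (at (snd c x)))" for c U u
  define P where "P = {(U, u). open U \<and> path_connected U \<and> (\<exists>c. prim c U u)}"
  have any_chart: "((u \<circ> chart_inv d) has_derivative \<theta> d (snd d x)) (at (snd d x))"
    if U: "(U, u) \<in> P" and "d \<in> A" "x \<in> U" "x \<in> fst d" for U u d x
  proof -
    from U obtain c where "prim c U u" by (auto simp: P_def)
    then have c: "c \<in> A" "x \<in> fst c" "((u \<circ> chart_inv c) has_derivative \<theta> c (snd c x)) (at (snd c x))"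
      using that(3) by (auto simp: prim_def)
    have "\<theta> d (snd d x) = (\<lambda>v. \<theta> c (snd c x) (frechet_derivative (transition d c) (at (snd d x)) v))"
      using one_formD(3)[OF \<theta> that(2) c(1) that(4) c(2)] by blast
    then show ?thesis using has_derivative_chart_change[OF c(1) that(2) c(2) that(4) c(3)] by simp
  qed
  interpret local_primitives P
  proof
    show "open U" "path_connected U" if "(U, u) \<in> P" for U u using that by (auto simp: P_def)
  next
    fix x :: 'a
    define c where "c = chart_at A x"
    have c: "c \<in> A" "x \<in> fst c" using chart_at[OF manifold] by (auto simp: c_def)
    obtain r where r: "r > 0" "ball (snd c x) r \<subseteq> chart_image c"
      using chart_open(2)[OF c(1)] c(2) open_contains_ball by blast
    let ?B = "ball (snd c x) r"
    let ?D = "\<lambda>z v. frechet_derivative (\<lambda>y. \<theta> c y v) (at z)"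
    note sm = one_formD(2)[OF \<theta> c(1)]
    obtain u where u: "\<And>z. z \<in> ?B \<Longrightarrow> (u has_derivative \<theta> c z) (at z)"
    proof (rule closed_one_form_primitive[of ?B "snd c x" "\<theta> c" ?D])
      show "linear (\<theta> c z)" if "z \<in> ?B" for z
        using one_formD(1)[OF \<theta> c(1)] r that by blast
      show "((\<lambda>y. \<theta> c y v) has_derivative ?D z v) (at z)" if "z \<in> ?B" for z v
        using smooth_on_has_derivative[OF sm] r that by blast
      show "continuous_on ?B (\<lambda>z. ?D z v w)" for v w
        using continuous_on_subset[OF smooth_on_continuous_on[OF smooth_on_frechet_derivative[OF sm]] r(2)] .
      \<comment> \<open>Closedness is exactly this symmetry of the first derivatives of the
        coefficients.\<close>
      show "?D z v w = ?D z w v" if "z \<in> ?B" for z v w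
        using closed[OF c(1), of z w v] r that by (auto simp: ext_deriv1_def)
    qed (use r in auto)
    define U where "U = fst c \<inter> snd c -` ?B"
    have U: "U = chart_inv c ` ?B"
    proof (intro set_eqI iffI)
      fix y assume "y \<in> U"
      then show "y \<in> chart_inv c ` ?B"
        using chart_inv_chart[OF c(1), of y] by (intro image_eqI[of _ _ "snd c y"]) (auto simp: U_def)
    next
      fix y assume "y \<in> chart_inv c ` ?B"
      then obtain z where z: "z \<in> ?B" "y = chart_inv c z" by blast
      then show "y \<in> U" using chart_inv_mem[of z c] r(2) unfolding U_def by auto
    qed
    have "path_connected U" unfolding U
      using continuous_on_subset[OF chart_inv_continuous[OF c(1)] r(2)]
      by (intro path_connected_continuous_image convex_imp_path_connected) auto
    moreover have "open U" unfolding U_def by (rule chart_open(3)[OF c(1) open_ball])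
    moreover have "prim c U (u \<circ> snd c)"
      unfolding prim_def
    proof (intro conjI ballI)
      fix y assume y: "y \<in> U"
      show "((u \<circ> snd c \<circ> chart_inv c) has_derivative \<theta> c (snd c y)) (at (snd c y))"
      proof (rule has_derivative_transform_within_open)
        show "snd c y \<in> ?B" using y by (simp add: U_def)
        then show "(u has_derivative \<theta> c (snd c y)) (at (snd c y))" by (rule u)
        show "u z = (u \<circ> snd c \<circ> chart_inv c) z" if "z \<in> ?B" for z
          using chart_inv_mem[of z c] that r(2) by auto
      qed simp
    qed (use c U_def in auto)
    moreover have "x \<in> U" using c r by (simp add: U_def)
    ultimately have "(U, u \<circ> snd c) \<in> P \<and> x \<in> U"
      unfolding P_def mem_Collect_eq case_prod_conv by blast
    then show "\<exists>U u. (U, u) \<in> P \<and> x \<in> U" by blast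
  next
    fix U u W w x assume U: "(U, u) \<in> P" "x \<in> U" and W: "(W, w) \<in> P" "x \<in> W"
    define c where "c = chart_at A x"
    have c: "c \<in> A" "x \<in> fst c" using chart_at[OF manifold] by (auto simp: c_def)
    \<comment> \<open>The comparison takes place on a ball because a vanishing derivative forces a
      constant only on connected sets, and \<open>U \<inter> W\<close> need not be
      connected.\<close>
    have "open (snd c ` (fst c \<inter> (U \<inter> W)))"
      using U(1) W(1) by (intro chart_open(4)[OF c(1)]) (auto simp: P_def)
    then obtain r where r: "r > 0" "ball (snd c x) r \<subseteq> snd c ` (fst c \<inter> (U \<inter> W))"
      using U W c open_contains_ball by blast
    have d0: "((\<lambda>z. (u \<circ> chart_inv c) z - (w \<circ> chart_inv c) z) has_derivative (\<lambda>h. 0)) (at z)"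
      if z: "z \<in> ball (snd c x) r" for z
    proof -
      obtain y where y: "z = snd c y" "y \<in> fst c" "y \<in> U" "y \<in> W" using r z by blast
      show ?thesis
        using has_derivative_diff[OF any_chart[OF U(1) c(1) y(3,2)] any_chart[OF W(1) c(1) y(4,2)]]
        by (simp add: y(1))
    qed
    have "\<exists>k. \<forall>z\<in>ball (snd c x) r. (u \<circ> chart_inv c) z - (w \<circ> chart_inv c) z = k"
      by (rule has_derivative_zero_constant[OF convex_ball]) (rule has_derivative_at_withinI[OF d0])
    then obtain k where k: "\<And>z. z \<in> ball (snd c x) r \<Longrightarrow> (u \<circ> chart_inv c) z - (w \<circ> chart_inv c) z = k"
      by metis
    have k': "u y - w y = k" if "y \<in> fst c" "snd c y \<in> ball (snd c x) r" for y
      using k[OF that(2)] chart_inv_chart[OF c(1) that(1)] by simp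
    have "\<forall>\<^sub>F y in nhds x. y \<in> fst c \<inter> snd c -` ball (snd c x) r"
      using c r chart_open(3)[OF c(1) open_ball] by (intro eventually_nhds_in_open) auto
    then show "\<forall>\<^sub>F y in nhds x. u y - u x = w y - w x"
    proof eventually_elim
      case (elim y)
      then show ?case using k'[of y] k'[of x] c r by auto
    qed
  qed
  obtain f where f: "primitive_along id UNIV f" using primitive_along_id[OF sc] .
  have "((f \<circ> chart_inv c) has_derivative \<theta> c z) (at z)" if c: "c \<in> A" and z: "z \<in> chart_image c" for c z
  proof -
    define x where "x = chart_inv c z"
    have x: "x \<in> fst c" "snd c x = z" using chart_inv_mem[OF z] by (auto simp: x_def)
    obtain U u where U: "(U, u) \<in> P" "x \<in> U" using cover by blast
    obtain V where V: "open V" "x \<in> V" "\<And>y. y \<in> V \<Longrightarrow> f y - f x = u y - u x"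
      using primitive_alongD[OF f UNIV_I U(1), of x] U(2) unfolding eventually_nhds by auto
    have "((\<lambda>y. (u \<circ> chart_inv c) y + (f x - u x)) has_derivative \<theta> c z) (at z)"
      using has_derivative_add[OF any_chart[OF U(1) c U(2) x(1)] has_derivative_const] x(2) by simp
    then show ?thesis
    proof (rule has_derivative_transform_within_open[OF _ chart_open(4)[OF c V(1)]])
      show "z \<in> snd c ` (fst c \<inter> V)" using x V by blast
      show "(u \<circ> chart_inv c) y + (f x - u x) = (f \<circ> chart_inv c) y" if y: "y \<in> snd c ` (fst c \<inter> V)" for y
      proof -
        obtain y' where "y' \<in> fst c" "y' \<in> V" "y = snd c y'" using y by blast
        then show ?thesis using V(3)[of y'] chart_inv_chart[OF c] by simp
      qed
    qed
  qed
  then show ?thesis by (intro that ballI)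
qed

end

section \<open>Comparison with the potential\<close>

text \<open>Along the line through \<open>z\<close> in direction \<open>v\<close> the first
  derivative vanishes at the maximum. Were \<open>D2 v\<close> positive, it would be positive just
  afterwards, and the mean value theorem would produce a larger value of \<open>G\<close>.\<close>

lemma second_derivative_at_max:
  fixes G :: "'e::real_normed_vector \<Rightarrow> real"
  assumes S: "open S" "z \<in> S"
    and D: "\<And>y. y \<in> S \<Longrightarrow> (G has_derivative D y) (at y)"
    and D2: "((\<lambda>y. D y v) has_derivative D2) (at z)"
    and max: "\<And>y. y \<in> S \<Longrightarrow> G y \<le> G z"
  shows "D2 v \<le> 0"
proof (rule ccontr)
  assume pos: "\<not> D2 v \<le> 0"
  define p where "p t = z + t *\<^sub>R v" for t :: real
  have p: "(p has_derivative (\<lambda>s. s *\<^sub>R v)) (at t)" for t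
    unfolding p_def by (auto intro!: derivative_eq_intros)
  have p0: "p 0 = z" by (simp add: p_def)
  have "isCont p 0" using has_derivative_continuous[OF p] .
  then have "\<forall>\<^sub>F t in at 0. p t \<in> S"
    using S p0 by (auto simp: isCont_def dest: topological_tendstoD)
  then obtain e where e: "e > 0" "\<And>t. \<lbrakk>t \<noteq> 0; \<bar>t\<bar> < e\<rbrakk> \<Longrightarrow> p t \<in> S"
    unfolding eventually_at by (auto simp: dist_real_def)
  have pS: "p t \<in> S" if "\<bar>t\<bar> < e" for t using e(2)[of t] that p0 S(2) by (cases "t = 0") auto
  have d1: "((\<lambda>t. G (p t)) has_real_derivative D (p t) v) (at t)" if "\<bar>t\<bar> < e" for t
    using has_derivative_compose[OF p D[OF pS[OF that]]]
      linear_scale[OF has_derivative_linear[OF D[OF pS[OF that]]]]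
    by (intro has_derivative_imp_has_field_derivative) auto
  have d2: "((\<lambda>t. D (p t) v) has_real_derivative D2 v) (at 0)"
    using has_derivative_compose[OF p[of 0], of "\<lambda>y. D y v" D2] D2
      linear_scale[OF has_derivative_linear[OF D2]]
    by (intro has_derivative_imp_has_field_derivative) (auto simp: p0)
  have "D z = (\<lambda>_. 0)"
    using differential_zero_maxmin[OF S(2,1) D[OF S(2)]] max by blast
  then have D0: "D (p 0) v = 0" by (simp add: p0)
  obtain d where d: "d > 0" "\<And>h. \<lbrakk>0 < h; h < d\<rbrakk> \<Longrightarrow> D (p 0) v < D (p (0 + h)) v"
    using DERIV_pos_inc_right[OF d2] pos by auto
  \<comment> \<open>Below \<open>d\<close> the slope is positive, below \<open>e\<close> the line
    stays in \<open>S\<close>; halving makes both inequalities strict.\<close>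
  define t where "t = min d e / 2"
  have t: "0 < t" "t < d" "t < e" using d(1) e(1) by (auto simp: t_def)
  obtain s where s: "0 < s" "s < t" "G (p t) - G (p 0) = (t - 0) * D (p s) v"
    using MVT2[of 0 t "\<lambda>t. G (p t)" "\<lambda>t. D (p t) v"] d1 t by (metis abs_of_nonneg order.strict_trans1)
  have "0 < D (p s) v" using d(2)[of s] s t D0 by simp
  then have "G (p t) > G (p 0)" using s t by (smt (verit) mult_pos_pos)
  then show False using max[OF pS[of t]] t p0 by simp
qed

section \<open>Linear algebra of the metric at a point\<close>

context hermitian_point
begin

lemma riem_scale: "riem \<omega> c z (r *\<^sub>R v) (r *\<^sub>R v) = r\<^sup>2 * riem \<omega> c z v v"
proof -
  have "\<i> *s (r *\<^sub>R v) = r *\<^sub>R (\<i> *s v)" by (simp add: vec_eq_iff)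
  then show ?thesis by (simp add: riem_def bil_simps power2_eq_square)
qed

lemma riem_nonneg: "0 \<le> riem \<omega> c z v v"
  using pos[of v] by (cases "v = 0") (auto simp: riem_def bil_simps)

text \<open>The metric has a positive minimum \<open>m\<close> on the compact Euclidean sphere;
  homogeneity bounds its unit ball by radius \<open>sqrt (1 / m)\<close>. This makes the supremum
  defining \<open>local_form_norm\<close> one of a bounded set.\<close>

lemma unit_ball_bounded: "\<exists>M. \<forall>v. riem \<omega> c z v v \<le> 1 \<longrightarrow> norm v \<le> M"
proof -
  have bb: "bounded_bilinear (\<omega> c z)" using bil bilinear_conv_bounded_bilinear by blast
  have "linear (\<lambda>v :: complex ^ 'n. \<i> *s v)"
    by (rule linearI) (simp_all add: vec_eq_iff algebra_simps)
  then have "continuous_on (sphere 0 1) (\<lambda>v :: complex ^ 'n. \<i> *s v)"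
    by (intro linear_continuous_on) (simp only: linear_conv_bounded_linear)
  from bounded_bilinear.continuous_on[OF bb continuous_on_id this]
  have "continuous_on (sphere 0 1) (\<lambda>v. \<omega> c z v (\<i> *s v))" .
  moreover have "sphere (0 :: complex ^ 'n) 1 \<noteq> {}" by simp
  ultimately obtain w where w: "w \<in> sphere 0 1"
      "\<And>v. v \<in> sphere 0 1 \<Longrightarrow> \<omega> c z w (\<i> *s w) \<le> \<omega> c z v (\<i> *s v)"
    using continuous_attains_inf[OF compact_sphere] by blast
  define m where "m = riem \<omega> c z w w"
  have "w \<noteq> 0" using w(1) by auto
  then have m: "m > 0" using pos by (simp add: m_def riem_def)
  have "norm v \<le> sqrt (1 / m)" if v: "riem \<omega> c z v v \<le> 1" for v
  proof (cases "v = 0")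
    case False
    have "m \<le> riem \<omega> c z ((1 / norm v) *\<^sub>R v) ((1 / norm v) *\<^sub>R v)"
      using w(2)[of "(1 / norm v) *\<^sub>R v"] False by (simp add: m_def riem_def)
    also have "\<dots> = riem \<omega> c z v v / (norm v)\<^sup>2" by (simp add: riem_scale power_divide)
    also have "\<dots> \<le> 1 / (norm v)\<^sup>2" using v by (simp add: divide_right_mono)
    finally have "(norm v)\<^sup>2 \<le> 1 / m" using m False by (simp add: field_simps)
    then show ?thesis by (rule real_le_rsqrt)
  qed (use m in simp)
  then show ?thesis by blast
qed

lemma bdd_above_form_values:
  fixes \<eta> :: "('a, 'n) form1"
  assumes "linear (\<eta> c z)"
  shows "bdd_above {\<bar>\<eta> c z v\<bar> | v. riem \<omega> c z v v \<le> 1}"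
proof -
  obtain M where M: "\<And>v. riem \<omega> c z v v \<le> 1 \<Longrightarrow> norm v \<le> M" using unit_ball_bounded by blast
  obtain K where K: "K > 0" "\<And>v. norm (\<eta> c z v) \<le> norm v * K"
    using assms linear_conv_bounded_linear bounded_linear.pos_bounded by metis
  have "\<bar>\<eta> c z v\<bar> \<le> M * K" if "riem \<omega> c z v v \<le> 1" for v
    using order_trans[OF K(2)[of v] mult_right_mono[OF M[OF that] less_imp_le[OF K(1)]]]
    by (simp only: real_norm_def)
  then show ?thesis by (intro bdd_aboveI[of _ "M * K"]) auto
qed

lemma local_form_norm_nonneg:
  fixes \<eta> :: "('a, 'n) form1"
  assumes "linear (\<eta> c z)"
  shows "0 \<le> local_form_norm \<omega> \<eta> c z"
proof -
  have "\<bar>\<eta> c z 0\<bar> \<in> {\<bar>\<eta> c z v\<bar> | v. riem \<omega> c z v v \<le> 1}"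
    by (intro CollectI exI[of _ 0]) (simp add: riem_def bil_simps)
  from cSup_upper[OF this bdd_above_form_values[of \<eta>, OF assms]]
  show ?thesis unfolding local_form_norm_def by linarith
qed

lemma abs_le_local_form_norm:
  fixes \<eta> :: "('a, 'n) form1"
  assumes lin: "linear (\<eta> c z)"
  shows "\<bar>\<eta> c z v\<bar> \<le> local_form_norm \<omega> \<eta> c z * sqrt (riem \<omega> c z v v)"
proof (cases "v = 0")
  case True
  then show ?thesis using linear_0[OF lin] by (simp add: riem_def bil_simps)
next
  case False
  define r where "r = sqrt (riem \<omega> c z v v)"
  have r: "r > 0" "r\<^sup>2 = riem \<omega> c z v v" using pos[OF False] by (auto simp: r_def riem_def)
  have "riem \<omega> c z ((1 / r) *\<^sub>R v) ((1 / r) *\<^sub>R v) = (1 / r)\<^sup>2 * r\<^sup>2"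
    by (simp only: riem_scale r(2))
  also have "\<dots> = 1" using r(1) by (simp add: power_divide)
  finally have "\<bar>\<eta> c z ((1 / r) *\<^sub>R v)\<bar> \<le> local_form_norm \<omega> \<eta> c z"
    unfolding local_form_norm_def by (intro cSup_upper bdd_above_form_values lin CollectI exI[of _ "(1 / r) *\<^sub>R v"]) auto
  then have "\<bar>\<eta> c z v\<bar> / r \<le> local_form_norm \<omega> \<eta> c z"
    using r(1) by (simp add: linear_scale[OF lin] abs_mult)
  then show ?thesis using r(1) by (simp add: field_simps flip: r_def)
qed

text \<open>\<open>T b\<close> represents \<open>riem \<omega> c z v b\<close> in the Euclidean
  inner product. Positivity makes \<open>T\<close> injective, hence surjective in finite
  dimension.\<close>

lemma riesz_representation:
  assumes lin: "linear L"
  obtains b where "\<And>v. L v = riem \<omega> c z v b"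
proof -
  define T where "T b = (\<Sum>e\<in>Basis. riem \<omega> c z e b *\<^sub>R e)" for b
  have ladd: "\<i> *s (x + y) = \<i> *s x + \<i> *s (y :: complex ^ 'n)" for x y
    by (simp add: vec_eq_iff algebra_simps)
  have lscale: "\<i> *s (r *\<^sub>R x) = r *\<^sub>R (\<i> *s (x :: complex ^ 'n))" for r x
    by (simp add: vec_eq_iff)
  have linT: "linear T"
    by (rule linearI) (simp_all add: T_def riem_def ladd lscale bil_simps scaleR_left_distrib
        sum.distrib scaleR_sum_right)
  have T: "v \<bullet> T b = riem \<omega> c z v b" for v b
  proof -
    have lin': "linear (\<lambda>v. riem \<omega> c z v b)"
      by (rule linearI) (simp_all add: riem_def bil_simps)
    have "v \<bullet> T b = (\<Sum>e\<in>Basis. (v \<bullet> e) * riem \<omega> c z e b)"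
      by (simp add: T_def inner_sum_right mult.commute)
    also have "\<dots> = riem \<omega> c z (\<Sum>e\<in>Basis. (v \<bullet> e) *\<^sub>R e) b"
      by (simp add: linear_sum[OF lin'] linear_scale[OF lin'])
    finally show ?thesis by (simp add: euclidean_representation)
  qed
  have "inj T"
  proof (subst linear_injective_0[OF linT], intro allI impI)
    fix b assume "T b = 0"
    then have "riem \<omega> c z b b = 0" using T[of b b] by simp
    then show "b = 0" using pos[of b] by (auto simp: riem_def)
  qed
  then have "surj T" using linear_injective_imp_surjective[OF linT] by blast
  then obtain b where b: "T b = (\<Sum>e\<in>Basis. L e *\<^sub>R e)" by (metis surjD)
  have "L v = riem \<omega> c z v b" for v
  proof -
    have "L v = L (\<Sum>e\<in>Basis. (v \<bullet> e) *\<^sub>R e)" by (simp add: euclidean_representation)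
    also have "\<dots> = (\<Sum>e\<in>Basis. (v \<bullet> e) * L e)"
      by (simp add: linear_sum[OF lin] linear_scale[OF lin])
    also have "\<dots> = v \<bullet> T b" by (simp add: b inner_sum_right mult.commute)
    finally show ?thesis by (simp add: T)
  qed
  then show ?thesis by (rule that)
qed

end

text \<open>If every \<open>R\<close> failed, points with \<open>g \<ge> n\<close> and
  \<open>F \<le> C'\<close> would leave each compact set, since the continuous \<open>g\<close> is
  bounded there. Their lower limit would be at most \<open>C'\<close>.\<close>

lemma liminf_infinity_bound:
  fixes g F :: "'a::topological_space \<Rightarrow> real"
  assumes g: "continuous_on UNIV g" and F: "ereal C \<le> liminf_infinity F" and "C' < C"
  obtains R where "\<And>x. g x \<ge> R \<Longrightarrow> F x > C'"
proof (rule ccontr)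
  assume "\<not> thesis"
  then have "\<exists>x. g x \<ge> real n \<and> F x \<le> C'" for n using that by (meson not_le)
  then obtain s where s: "\<And>n. g (s n) \<ge> real n" "\<And>n. F (s n) \<le> C'" by metis
  have "compactly_divergent s"
    unfolding compactly_divergent_def
  proof (intro allI impI)
    fix K :: "'a set" assume "compact K"
    then have "bounded (g ` K)"
      using continuous_on_subset[OF g] compact_continuous_image compact_imp_bounded by blast
    then obtain b where b: "\<And>x. x \<in> K \<Longrightarrow> \<bar>g x\<bar> \<le> b" by (auto simp: bounded_iff)
    obtain N where N: "real N > b" using reals_Archimedean2 by blast
    have "s j \<notin> K" if "j \<ge> N" for j
    proof
      assume "s j \<in> K"
      then show False using b[of "s j"] s(1)[of j] N that by linarith
    qed
    then show "\<exists>N. \<forall>j\<ge>N. s j \<notin> K" by blast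
  qed
  then have "liminf_infinity F \<le> liminf (\<lambda>j. ereal (F (s j)))"
    unfolding liminf_infinity_def by (intro Inf_lower) blast
  with F have "ereal C \<le> liminf (\<lambda>j. ereal (F (s j)))" by (rule order_trans)
  also have "\<dots> \<le> liminf (\<lambda>j::nat. ereal C')"
    using s(2) by (intro Liminf_mono) auto
  finally show False using \<open>C' < C\<close> by (simp add: Liminf_const)
qed

section \<open>Extremal points of the potential and of the primitive\<close>

context atlas
begin

lemma continuous_on_chartwise:
  fixes h :: "'a \<Rightarrow> real"
  assumes "\<And>c z. c \<in> A \<Longrightarrow> z \<in> chart_image c \<Longrightarrow> ((h \<circ> chart_inv c) has_derivative D c z) (at z)"
  shows "continuous_on UNIV h"
proof -
  have "continuous_on (fst c) h" if c: "c \<in> A" for c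
  proof -
    have "continuous_on (chart_image c) (h \<circ> chart_inv c)"
      using has_derivative_continuous[OF assms[OF c]] continuous_at_imp_continuous_on by blast
    moreover have "continuous_on (fst c) (snd c)"
      using is_chart[OF c] unfolding is_chart_def by (meson homeomorphism_cont1)
    ultimately have "continuous_on (fst c) (\<lambda>x. (h \<circ> chart_inv c) (snd c x))"
      by (rule continuous_on_compose2) auto
    moreover have "(h \<circ> chart_inv c) (snd c x) = h x" if "x \<in> fst c" for x
      using chart_inv_chart[OF c that] by simp
    ultimately show ?thesis using continuous_on_cong[OF refl] by fastforce
  qed
  then have "continuous_on (\<Union>c\<in>A. fst c) h"
    by (intro continuous_on_open_UN chart_open(1))
  then show ?thesis using manifold unfolding complex_manifold_def by simp
qed

text \<open>With \<open>- dg o J / 2\<close> for \<open>dc g\<close>, the value of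
  \<open>\<omega>\<close> on \<open>v\<close> and \<open>\<i> *s v\<close> becomes half the sum of
  the second derivatives of \<open>g\<close> along these two vectors. It is positive, whereas both
  are nonpositive at a maximum.\<close>

lemma strictly_psh_no_max:
  assumes \<omega>: "kaehler_form A \<omega>" and g: "smooth_function A g"
    and eq: "eq_form2 A (ext_deriv1 (dc g)) \<omega>"
  shows "\<exists>y. g y > g x"
proof (rule ccontr)
  assume max: "\<not> ?thesis"
  define c where "c = chart_at A x"
  define z where "z = snd c x"
  have c: "c \<in> A" "x \<in> fst c" using chart_at[OF manifold] by (auto simp: c_def)
  have z: "z \<in> chart_image c" using c by (auto simp: z_def)
  let ?G = "g \<circ> chart_inv c"
  let ?D = "\<lambda>y. frechet_derivative ?G (at y)"
  let ?D2 = "\<lambda>u. frechet_derivative (\<lambda>y. ?D y u) (at z)"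
  have sm: "smooth_on ?G (chart_image c)" using g c by (simp add: smooth_function_def)
  note D = smooth_function_has_derivative[OF g c(1)]
  have D2: "((\<lambda>y. ?D y u) has_derivative ?D2 u) (at z)" for u
    by (rule smooth_on_has_derivative[OF smooth_on_frechet_derivative[OF sm] z])
  have nonpos: "?D2 u u \<le> 0" for u
  proof (rule second_derivative_at_max[OF chart_open(2)[OF c(1)] z D D2])
    show "?G y \<le> ?G z" for y
      using max chart_inv_chart[OF c] by (simp add: z_def not_less)
  qed
  have fd_dc: "frechet_derivative (\<lambda>y. dc g c y w) (at z) = (\<lambda>v. - ?D2 (\<i> *s w) v / 2)" for w
  proof -
    have "((\<lambda>y. dc g c y w) has_derivative (\<lambda>v. - ?D2 (\<i> *s w) v / 2)) (at z)"
    proof (rule has_derivative_transform_within_open[OF _ chart_open(2)[OF c(1)] z])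
      show "((\<lambda>y. - ?D y (\<i> *s w) / 2) has_derivative (\<lambda>v. - ?D2 (\<i> *s w) v / 2)) (at z)"
        by (auto intro!: derivative_eq_intros D2)
    qed (simp add: dc_eq_derivative[OF D])
    then show ?thesis using frechet_derivative_at by metis
  qed
  have D2_minus: "?D2 (- u) v = - ?D2 u v" for u v
  proof -
    have "((\<lambda>y. ?D y (- u)) has_derivative (\<lambda>v. - ?D2 u v)) (at z)"
    proof (rule has_derivative_transform_within_open[OF _ chart_open(2)[OF c(1)] z])
      show "((\<lambda>y. - ?D y u) has_derivative (\<lambda>v. - ?D2 u v)) (at z)"
        by (intro derivative_intros D2)
    qed (use linear_neg[OF has_derivative_linear[OF D]] in simp)
    then show ?thesis using frechet_derivative_at by metis
  qed
  define v :: "complex ^ 'n" where "v = 1"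
  have ii: "\<i> *s (\<i> *s v) = - v" by (simp add: vec_eq_iff)
  have "v \<noteq> 0" by (simp add: v_def)
  then have "riem \<omega> c z v v > 0"
    using \<omega> c(1) z unfolding kaehler_form_def by blast
  moreover have "riem \<omega> c z v v = ext_deriv1 (dc g) c z v (\<i> *s v)"
    using eq c(1) z unfolding riem_def eq_form2_def by metis
  moreover have "ext_deriv1 (dc g) c z v (\<i> *s v) = (?D2 v v + ?D2 (\<i> *s v) (\<i> *s v)) / 2"
    by (simp add: ext_deriv1_def fd_dc ii D2_minus add_divide_distrib)
  ultimately show False using nonpos[of v] nonpos[of "\<i> *s v"] by simp
qed

lemma abs_le_form_norm:
  assumes \<omega>: "kaehler_form A \<omega>" and \<eta>: "one_form A \<eta>"
  shows "\<bar>\<eta> (chart_at A x) (snd (chart_at A x) x) v\<bar> \<le> form_norm A \<omega> \<eta> x *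
      sqrt (riem \<omega> (chart_at A x) (snd (chart_at A x) x) v v)"
proof -
  let ?c = "chart_at A x"
  have c: "?c \<in> A" "snd ?c x \<in> chart_image ?c" using chart_at[OF manifold] by auto
  interpret hermitian_point \<omega> ?c "snd ?c x"
    by (rule hermitian_point_kaehler[OF \<omega> c])
  show ?thesis
    unfolding form_norm_def by (intro abs_le_local_form_norm one_formD(1)[OF \<eta> c])
qed

text \<open>\<open>b\<close> is the metric dual of \<open>dc g\<close>. It is killed by
  \<open>dg\<close> because \<open>dg(b)\<close> equals \<open>2 * dc g c z (\<i> *s b)\<close>,
  which is \<open>\<omega>\<close> on \<open>\<i> *s b\<close> twice, up to the factor 2. The norm
  bound is Cauchy-Schwarz.\<close>

lemma dc_norm_witness:
  fixes x :: 'a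
  assumes \<omega>: "kaehler_form A \<omega>" and g: "smooth_function A g"
  defines "c \<equiv> chart_at A x" and "z \<equiv> snd (chart_at A x) x"
  obtains b where "frechet_derivative (g \<circ> chart_inv c) (at z) b = 0"
    "dc g c z b = riem \<omega> c z b b" "(form_norm A \<omega> (dc g) x)\<^sup>2 \<le> riem \<omega> c z b b"
proof -
  have c: "c \<in> A" "z \<in> chart_image c" using chart_at[OF manifold] by (auto simp: c_def z_def)
  interpret hermitian_point \<omega> c z by (rule hermitian_point_kaehler[OF \<omega> c])
  note lin = one_formD(1)[OF one_form_dc[OF g] c]
  obtain b where b: "\<And>v. dc g c z v = riem \<omega> c z v b" using riesz_representation[OF lin] by metis
  note D = smooth_function_has_derivative[OF g c]
  have "frechet_derivative (g \<circ> chart_inv c) (at z) b = 2 * dc g c z (\<i> *s b)"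
    using dc_eq_derivative[OF D, of "\<i> *s b"] linear_neg[OF has_derivative_linear[OF D], of b]
    by (simp add: ii)
  also have "\<dots> = 0" by (simp add: b riem_def alt)
  finally have 1: "frechet_derivative (g \<circ> chart_inv c) (at z) b = 0" .
  have "local_form_norm \<omega> (dc g) c z \<le> sqrt (riem \<omega> c z b b)"
    unfolding local_form_norm_def
  proof (rule cSup_least)
    have "riem \<omega> c z 0 0 \<le> 1" by (simp add: riem_def bil_simps)
    then show "{\<bar>dc g c z v\<bar> |v. riem \<omega> c z v v \<le> 1} \<noteq> {}" by blast
  next
    fix y assume "y \<in> {\<bar>dc g c z v\<bar> |v. riem \<omega> c z v v \<le> 1}"
    then obtain v where v: "y = \<bar>riem \<omega> c z v b\<bar>" "riem \<omega> c z v v \<le> 1" by (auto simp: b)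
    have "(riem \<omega> c z v b)\<^sup>2 \<le> riem \<omega> c z v v * riem \<omega> c z b b"
      using riem_cauchy_schwarz by (simp add: riem_def)
    also have "\<dots> \<le> riem \<omega> c z b b"
      using mult_right_mono[OF v(2) riem_nonneg[of b]] by simp
    finally show "y \<le> sqrt (riem \<omega> c z b b)" using v(1) by (simp add: real_le_rsqrt)
  qed
  then have "(local_form_norm \<omega> (dc g) c z)\<^sup>2 \<le> (sqrt (riem \<omega> c z b b))\<^sup>2"
    using local_form_norm_nonneg[of "dc g", OF lin] by (rule power_mono)
  then have "(form_norm A \<omega> (dc g) x)\<^sup>2 \<le> riem \<omega> c z b b"
    using riem_nonneg[of b] by (simp add: form_norm_def c_def z_def)
  with 1 b show ?thesis using that by blast
qed

text \<open>At the minimum of \<open>f + k (g - m)\<^sup>2\<close> over a compact slab \<open>\<bar>g - m\<bar> \<le> 1\<close>, with \<open>k\<close> so large that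
  the minimum is not attained on the boundary, \<open>df\<close> is a multiple of \<open>dg\<close>.\<close>

lemma differentials_parallel:
  fixes f g :: "'a \<Rightarrow> real"
  assumes g: "smooth_function A g" "exhaustion_function g"
    and f: "\<forall>c\<in>A. \<forall>z\<in>chart_image c. ((f \<circ> chart_inv c) has_derivative \<theta> c z) (at z)"
  obtains x where "g x \<ge> g x1 - 1"
    "\<And>c v. \<lbrakk>c \<in> A; x \<in> fst c; frechet_derivative (g \<circ> chart_inv c) (at (snd c x)) v = 0\<rbrakk>
      \<Longrightarrow> \<theta> c (snd c x) v = 0"
proof -
  have gc: "continuous_on UNIV g"
    by (rule continuous_on_chartwise[OF smooth_function_has_derivative[OF g(1)]])
  have fc: "continuous_on UNIV f" by (rule continuous_on_chartwise[OF f[rule_format]])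
  define m where "m = g x1"
  define K where "K = {x. \<bar>g x - m\<bar> \<le> 1}"
  have "closed K" unfolding K_def
    by (intro closed_Collect_le continuous_intros gc)
  \<comment> \<open>Exhaustion concerns strict sublevel sets, while \<open>g\<close> may equal
    \<open>m + 1\<close> on \<open>K\<close>; hence the larger bound.\<close>
  moreover have "K \<subseteq> closure {x. g x < m + 2}"
    using closure_subset by (fastforce simp: K_def)
  moreover have "compact (closure {x. g x < m + 2})"
    using g(2) unfolding exhaustion_function_def by blast
  ultimately have K: "compact K" by (metis compact_Int_closed inf.absorb_iff2)
  have x1: "x1 \<in> K" by (simp add: K_def m_def)
  have "bounded (f ` K)"
    using continuous_on_subset[OF fc] K compact_continuous_image compact_imp_bounded by blast
  then obtain M where M: "\<And>x. x \<in> K \<Longrightarrow> \<bar>f x\<bar> \<le> M" by (auto simp: bounded_iff)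
  \<comment> \<open>On \<open>K\<close> the values of \<open>f\<close> differ by at most
    \<open>2 * M\<close>, so the penalty \<open>2 * M + 1\<close> on the boundary already loses
    against \<open>x1\<close>, where it is zero.\<close>
  define \<Phi> where "\<Phi> x = f x + (2 * M + 1) * (g x - m)\<^sup>2" for x
  have "continuous_on K \<Phi>" unfolding \<Phi>_def
    by (intro continuous_intros continuous_on_subset[OF fc] continuous_on_subset[OF gc]) auto
  then obtain x where x: "x \<in> K" "\<And>y. y \<in> K \<Longrightarrow> \<Phi> x \<le> \<Phi> y"
    using continuous_attains_inf[OF K] x1 by blast
  have interior: "\<bar>g x - m\<bar> < 1"
  proof (rule ccontr)
    assume "\<not> ?thesis"
    then have "\<bar>g x - m\<bar> = 1" using x(1) by (simp add: K_def)
    then have "(g x - m)\<^sup>2 = 1" by (metis power2_abs power_one)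
    then have "\<Phi> x = f x + 2 * M + 1" by (simp add: \<Phi>_def)
    moreover have "\<Phi> x1 = f x1" by (simp add: \<Phi>_def m_def)
    ultimately show False using x(2)[OF x1] M[OF x1] M[OF x(1)] by linarith
  qed
  have "\<theta> c (snd c x) v = 0"
    if c: "c \<in> A" "x \<in> fst c" and v: "frechet_derivative (g \<circ> chart_inv c) (at (snd c x)) v = 0" for c v
  proof -
    define z where "z = snd c x"
    have z: "z \<in> chart_image c" using c by (auto simp: z_def)
    have zx: "chart_inv c z = x" using chart_inv_chart[OF c] by (simp add: z_def)
    let ?D = "frechet_derivative (g \<circ> chart_inv c) (at z)"
    let ?W = "snd c ` (fst c \<inter> {y. \<bar>g y - m\<bar> < 1})"
    let ?\<Phi> = "\<lambda>y. (f \<circ> chart_inv c) y + (2 * M + 1) * ((g \<circ> chart_inv c) y - m)\<^sup>2"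
    have der: "(?\<Phi> has_derivative (\<lambda>v. \<theta> c z v +
        (2 * M + 1) * (of_nat 2 * (?D v - 0) * ((g \<circ> chart_inv c) z - m) ^ (2 - 1)))) (at z)"
      by (intro has_derivative_add has_derivative_mult_right has_derivative_power has_derivative_diff
          has_derivative_const f[rule_format, OF c(1) z] smooth_function_has_derivative[OF g(1) c(1) z])
    have opn: "open ?W"
      by (intro chart_open(4)[OF c(1)] open_Collect_less continuous_intros gc)
    have zW: "z \<in> ?W" using c(2) interior by (auto simp: z_def)
    have min: "?\<Phi> z \<le> ?\<Phi> y" if y: "y \<in> ?W" for y
    proof -
      obtain y' where y': "y' \<in> fst c" "\<bar>g y' - m\<bar> < 1" "y = snd c y'" using y by blast
      then show ?thesis
        using x(2)[of y'] chart_inv_chart[OF c(1) y'(1)] by (simp add: zx \<Phi>_def K_def)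
    qed
    \<comment> \<open>The second summand is a multiple of \<open>dg\<close>, so on a vector killed
      by \<open>dg\<close> the first-order condition leaves only \<open>\<theta>\<close>.\<close>
    have "(\<lambda>v. \<theta> c z v +
        (2 * M + 1) * (of_nat 2 * (?D v - 0) * ((g \<circ> chart_inv c) z - m) ^ (2 - 1))) = (\<lambda>v. 0)"
      by (rule differential_zero_maxmin[OF zW opn der]) (intro disjI2 ballI min)
    from fun_cong[OF this, of v] show ?thesis using v by (simp add: z_def)
  qed
  moreover have "g x \<ge> g x1 - 1" using interior by (simp add: m_def)
  ultimately show ?thesis using that by blast
qed

end

lemma Linf_norm_bound:
  fixes A :: "('a::{t2_space, second_countable_topology}, 'n::finite) chart set"
  assumes "complex_manifold A" and sc: "simply_connected (UNIV :: 'a set)"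
    and \<omega>: "kaehler_form A \<omega>" and g: "smooth_function A g" "exhaustion_function g"
    and ddc: "eq_form2 A (ext_deriv1 (dc g)) \<omega>"
    and liminf: "ereal C \<le> liminf_infinity (\<lambda>x. (form_norm A \<omega> (dc g) x)\<^sup>2)"
    and \<eta>: "one_form A \<eta>" "eq_form2 A (ext_deriv1 \<eta>) \<omega>"
  shows "ereal C \<le> (Linf_norm A \<omega> \<eta>)\<^sup>2"
proof (rule ccontr)
  interpret atlas A by standard fact
  assume neg: "\<not> ?thesis"
  have le: "ereal (form_norm A \<omega> \<eta> x) \<le> Linf_norm A \<omega> \<eta>" for x
    unfolding Linf_norm_def by (rule SUP_upper) simp
  \<comment> \<open>The norm is not \<open>\<infinity>\<close>, as its square would not be below
    \<open>C\<close>, and the value at any one point bounds it below by a real.\<close>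
  obtain B where B: "Linf_norm A \<omega> \<eta> = ereal B"
    using neg le[of undefined] by (cases "Linf_norm A \<omega> \<eta>") (auto simp: power2_eq_square)
  have BC: "B\<^sup>2 < C" using neg by (simp add: B not_le)
  have form_norm_le: "form_norm A \<omega> \<eta> x \<le> B" for x using le[of x] by (simp add: B)
  define \<theta> where "\<theta> = (\<lambda>c z v. \<eta> c z v - dc g c z v)"
  have \<theta>: "one_form A \<theta>" unfolding \<theta>_def by (rule one_form_diff[OF \<eta>(1) one_form_dc[OF g(1)]])
  have closed: "ext_deriv1 \<theta> c z v w = 0" if "c \<in> A" "z \<in> chart_image c" for c z v w
  proof -
    have "ext_deriv1 \<eta> c z v w = ext_deriv1 (dc g) c z v w"
      using \<eta>(2) ddc that unfolding eq_form2_def by metis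
    then show ?thesis
      using ext_deriv1_diff[OF \<eta>(1) one_form_dc[OF g(1)] that, of v w] by (simp add: \<theta>_def)
  qed
  obtain f where f: "\<forall>c\<in>A. \<forall>z\<in>chart_image c. ((f \<circ> chart_inv c) has_derivative \<theta> c z) (at z)"
    by (rule closed_one_form_exact[OF sc \<theta> closed])
  have gc: "continuous_on UNIV g"
    by (rule continuous_on_chartwise[OF smooth_function_has_derivative[OF g(1)]])
  obtain R where R: "\<And>x. g x \<ge> R \<Longrightarrow> (form_norm A \<omega> (dc g) x)\<^sup>2 > B\<^sup>2"
    using liminf_infinity_bound[OF gc liminf BC] by metis
  \<comment> \<open>The surplus 1 covers the possible drop of \<open>g\<close> from
    \<open>x1\<close> to the minimiser, which must still satisfy \<open>g x \<ge> R\<close>.\<close>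
  obtain x1 where x1: "g x1 \<ge> R + 1"
  proof (rule ccontr)
    assume "\<not> thesis"
    then have "{x. g x < R + 1} = UNIV" using that by (auto simp: not_le[symmetric])
    then have "compact (UNIV :: 'a set)"
      using g(2) unfolding exhaustion_function_def by (metis closure_UNIV)
    then obtain x where "\<And>y. g y \<le> g x"
      using continuous_attains_sup[OF _ _ gc] by auto
    then show False using strictly_psh_no_max[OF \<omega> g(1) ddc, of x] by (auto simp: not_less[symmetric])
  qed
  obtain x where x: "g x \<ge> g x1 - 1"
    "\<And>c v. \<lbrakk>c \<in> A; x \<in> fst c; frechet_derivative (g \<circ> chart_inv c) (at (snd c x)) v = 0\<rbrakk>
      \<Longrightarrow> \<theta> c (snd c x) v = 0"
    using differentials_parallel[OF g f] by metis
  define c z where "c = chart_at A x" and "z = snd (chart_at A x) x"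
  obtain b where b: "frechet_derivative (g \<circ> chart_inv c) (at z) b = 0"
    "dc g c z b = riem \<omega> c z b b" "(form_norm A \<omega> (dc g) x)\<^sup>2 \<le> riem \<omega> c z b b"
    using dc_norm_witness[OF \<omega> g(1)] unfolding c_def z_def by metis
  define r where "r = sqrt (riem \<omega> c z b b)"
  have big: "B\<^sup>2 < riem \<omega> c z b b" using R[of x] x(1) x1 b(3) by linarith
  \<comment> \<open>Strictness of the bound excludes \<open>b = 0\<close>, so \<open>r\<close> can
    be cancelled at the end.\<close>
  then have pos: "0 < riem \<omega> c z b b" using zero_le_power2[of B] by linarith
  then have r2: "r\<^sup>2 = riem \<omega> c z b b" by (simp add: r_def)
  have "\<theta> c z b = 0" using x(2)[of c b] b(1) chart_at[OF manifold, of x] by (simp add: c_def z_def)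
  then have "r\<^sup>2 = \<eta> c z b" using b(2) r2 by (simp add: \<theta>_def)
  also have "\<dots> \<le> form_norm A \<omega> \<eta> x * r"
    using abs_le_form_norm[OF \<omega> \<eta>(1), of x b] by (simp add: c_def z_def r_def)
  also have "\<dots> \<le> B * r" using form_norm_le pos by (intro mult_right_mono) (auto simp: r_def)
  finally have "r\<^sup>2 \<le> B * r" .
  moreover have "r > 0" using pos by (simp add: r_def)
  ultimately have "r \<le> B" by (simp add: power2_eq_square)
  then have "r\<^sup>2 \<le> B\<^sup>2" using \<open>r > 0\<close> by (intro power_mono) auto
  then show False using big r2 by simp
qed

theorem theorem2p1:
  fixes A :: "('a::{t2_space, second_countable_topology}, 'n::finite) chart set"
    and \<omega> :: "('a, 'n) form2"
    and g :: "'a \<Rightarrow> real"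
    and C :: real
  assumes "complex_manifold A"
    and "simply_connected (UNIV :: 'a set)"
    and "kaehler_form A \<omega>"
    and "complete_metric A \<omega>"
    and "smooth_function A g"
    and "eq_form2 A (ext_deriv1 (dc g)) \<omega>"
    and "exhaustion_function g"
    and "C > 0"
    and "1 / 2 * liminf_infinity (del_norm_sq A \<omega> g) = 
         liminf_infinity (\<lambda>x. (form_norm A \<omega> (dc g) x)\<^sup>2)"
    and "liminf_infinity (\<lambda>x. (form_norm A \<omega> (dc g) x)\<^sup>2) \<ge> ereal C"
  shows "(\<forall>\<eta>. one_form A \<eta> \<and> eq_form2 A (ext_deriv1 \<eta>) \<omega> \<longrightarrow> (Linf_norm A \<omega> \<eta>)\<^sup>2 \<ge> ereal C)
    \<and> kaehler_hyp_modulus A \<omega> \<ge> ereal C"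
proof -
  have "ereal C \<le> (Linf_norm A \<omega> \<eta>)\<^sup>2"
    if "one_form A \<eta>" "eq_form2 A (ext_deriv1 \<eta>) \<omega>" for \<eta>
    using Linf_norm_bound[OF assms(1,2,3,5,7,6,10) that] .
  then show ?thesis unfolding kaehler_hyp_modulus_def by (auto intro: Inf_greatest)
qed

end
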